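(* Let $(\mathfrak{g},\mathfrak{n})$ be a pair of finite-dimensional complex Lie algebras on the same underlying vector space, where $\mathfrak{g}$ is reductive with $1$-dimensional center, and $\mathfrak{n}$ is solvable and non-nilpotent. Then there is no post-Lie algebra structure on $(\mathfrak{g},\mathfrak{n})$.
   Context: Let $\mathfrak{g}=(V,[\,,])$ and $\mathfrak{n}=(V,\{\,,\})$ be two Lie algebra structures on the same complex vector space $V$. A post-Lie algebra structure on the pair $(\mathfrak{g},\mathfrak{n})$ is a bilinear product $(x,y)\mapsto x\cdot y$ on $V$ such that for all $x,y,z\in V$: (i) $x\cdot y-y\cdot x=[x,y]-\{x,y\}$; (ii) $[x,y]\cdot z=x\cdot(y\cdot z)-y\cdot(x\cdot z)$; (iii) $x\cdot\{y,z\}=\{x\cdot y,z\}+\{y,x\cdot z\}$. *)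

theory Defs
  imports Complex_Main
begin

definition bilinear_product ::
    "('k::field \<Rightarrow> 'v::ab_group_add \<Rightarrow> 'v) \<Rightarrow> ('v \<Rightarrow> 'v \<Rightarrow> 'v) \<Rightarrow> bool"
  where "bilinear_product scale p \<longleftrightarrow>
    (\<forall>x. Vector_Spaces.linear scale scale (\<lambda>y. p x y)) \<and>
    (\<forall>y. Vector_Spaces.linear scale scale (\<lambda>x. p x y))"

text \<open>The underlying vector space is the whole type \<^typ>\<open>'v\<close>, so that several brackets can
  live on the same space.\<close>

locale lie_algebra = vector_space scale
  for scale :: "'k::field \<Rightarrow> 'v::ab_group_add \<Rightarrow> 'v" +
  fixes bracket :: "'v \<Rightarrow> 'v \<Rightarrow> 'v"
  assumes bilinear: "bilinear_product scale bracket"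
    and alternating: "bracket x x = 0"
    and jacobi: "bracket x (bracket y z) + bracket y (bracket z x) + bracket z (bracket x y) = 0"
begin

definition center :: "'v set"
  where "center = {x. \<forall>y. bracket x y = 0}"

definition ideal :: "'v set \<Rightarrow> bool"
  where "ideal I \<longleftrightarrow> subspace I \<and> (\<forall>x. \<forall>y\<in>I. bracket x y \<in> I)"

definition bracket_space :: "'v set \<Rightarrow> 'v set \<Rightarrow> 'v set"
  where "bracket_space A B = span {bracket a b | a b. a \<in> A \<and> b \<in> B}"

primrec derived_series :: "nat \<Rightarrow> 'v set"
  where
    "derived_series 0 = UNIV"
  | "derived_series (Suc k) = bracket_space (derived_series k) (derived_series k)"

primrec lower_central_series :: "nat \<Rightarrow> 'v set"
  where
    "lower_central_series 0 = UNIV"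
  | "lower_central_series (Suc k) = bracket_space UNIV (lower_central_series k)"

definition solvable :: bool
  where "solvable \<longleftrightarrow> (\<exists>k. derived_series k = {0})"

definition nilpotent :: bool
  where "nilpotent \<longleftrightarrow> (\<exists>k. lower_central_series k = {0})"

text \<open>Reductive means that the adjoint representation is completely reducible (the definition of
  Bourbaki and Knapp). The subrepresentations of the adjoint representation are exactly the
  ideals, so every ideal has to possess a complementary ideal.\<close>

definition reductive :: bool
  where "reductive \<longleftrightarrow>
    (\<forall>I. ideal I \<longrightarrow>
      (\<exists>J. ideal J \<and> I \<inter> J = {0} \<and> {x + y | x y. x \<in> I \<and> y \<in> J} = UNIV))"

end

definition post_lie_structure ::
    "('k::field \<Rightarrow> 'v::ab_group_add \<Rightarrow> 'v) \<Rightarrow> ('v \<Rightarrow> 'v \<Rightarrow> 'v) \<Rightarrow> ('v \<Rightarrow> 'v \<Rightarrow> 'v) \<Rightarrow>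
      ('v \<Rightarrow> 'v \<Rightarrow> 'v) \<Rightarrow> bool"
  where "post_lie_structure scale brg brn p \<longleftrightarrow>
    bilinear_product scale p \<and>
    (\<forall>x y. p x y - p y x = brg x y - brn x y) \<and>
    (\<forall>x y z. p (brg x y) z = p x (p y z) - p y (p x z)) \<and>
    (\<forall>x y z. p x (brn y z) = brn (p x y) z + brn y (p x z))"

end

theory Submission
  imports Defs "HOL-Computational_Algebra.Fundamental_Theorem_Algebra"
begin

text \<open>
  Write \<open>L x\<close> for the map \<open>y \<mapsto> x \<cdot> y\<close>, write \<open>ad x\<close> for \<open>y \<mapsto> {x, y}\<close>, and let \<open>s = [g, g]\<close>.
  The \<open>L x\<close> are derivations of \<open>n\<close>, and \<open>x \<mapsto> L x\<close> is a representation of \<open>g\<close>. As \<open>g\<close> is reductive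
  with one-dimensional center, \<open>s\<close> is perfect and has codimension at most one
  (\<open>reductive_derived_algebra\<close>).

  Let \<open>I\<close> be the span of the images of all \<open>L x\<close> and \<open>ad x\<close>. Since
  \<open>[x, y] = x \<cdot> y - y \<cdot> x + {x, y}\<close>, it contains \<open>s\<close>. Derivations map a solvable Lie algebra into
  its nilradical; the form of this fact that is used here is a flag of \<open>V\<close> that all \<open>L x\<close> and
  \<open>ad x\<close> preserve and that \<open>ad i\<close> lowers by one step for every \<open>i \<in> I\<close> (\<open>solvable_flag\<close>, a
  consequence of Lie's theorem). If \<open>I\<close> were everything, \<open>n\<close> would be nilpotent. Hence \<open>I\<close> is a
  proper subspace that contains \<open>s\<close>, and by dimension \<open>I = s\<close>. In particular all products
  \<open>x \<cdot> y\<close> lie in \<open>s\<close>.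

  Consider the invariant form \<open>trace (L x L y)\<close> on \<open>s\<close>. Suppose that it is nondegenerate on an ideal
  \<open>J\<close> contained in \<open>s\<close>, take dual bases \<open>b\<close> and \<open>d b\<close> of \<open>J\<close>, and put \<open>w = \<Sum> d b \<cdot> b\<close>.
  Invariance of the Casimir tensor shows that the right multiplication by \<open>w\<close> is
  \<open>\<Sum> L (d b) L b + \<Sum> ad b L (d b) + ad w\<close> (\<open>casimir_right_mult\<close>). The first sum has trace
  \<open>dim J\<close>, and the operators in the second one are strictly triangular for the flag. On the other
  hand \<open>w \<in> I = s\<close>, and \<open>ad v\<close> and the right multiplication by \<open>v\<close> have trace zero whenever
  \<open>v \<in> [g, g]\<close> (\<open>trace_brn_zero\<close>, \<open>trace_right_mult_zero\<close>). Thus \<open>J = 0\<close>. Applied to a complement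
  of the radical of the form, this shows that the form vanishes on \<open>s\<close>.

  By Cartan's criterion (\<open>cartan_nilpotent\<close>) every \<open>L x\<close> with \<open>x \<in> s\<close> is then nilpotent. A
  complement of the kernel of \<open>L\<close> in \<open>s\<close> is perfect, and it is also solvable, as it acts faithfully
  by nilpotent operators (\<open>nilpotent_action_solvable\<close>). So it is zero and \<open>L\<close> vanishes on
  \<open>s\<close>. Now the two brackets agree on \<open>s\<close>, which makes \<open>s\<close> a perfect subalgebra of the solvable
  algebra \<open>n\<close>. Therefore \<open>s = 0\<close>, hence \<open>I = 0\<close>, and \<open>n\<close> is abelian, which contradicts that it is
  not nilpotent.
\<close>

section \<open>Traces on invariant subspaces\<close>

locale complex_space = finite_dimensional_vector_space scale basis
  for scale :: "complex \<Rightarrow> 'v::ab_group_add \<Rightarrow> 'v" (infixr \<open>*s\<close> 75)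
    and basis :: "'v set"
begin

abbreviation lin :: "('v \<Rightarrow> 'v) \<Rightarrow> bool"
  where "lin T \<equiv> Vector_Spaces.linear scale scale T"

lemma linI:
  assumes "\<And>x y. T (x + y) = T x + T y" and "\<And>c x. T (c *s x) = c *s T x"
  shows "lin T"
  by (rule linear_module_homI, unfold_locales) (auto simp: assms)

lemma lin_hom: "lin T \<Longrightarrow> module_hom scale scale T"
  by (simp add: module_hom_eq_linear)

lemmas lin_add = lin_hom[THEN module_hom.add]
  and lin_scale = lin_hom[THEN module_hom.scale]
  and lin_0 = lin_hom[THEN module_hom.zero]
  and lin_neg = lin_hom[THEN module_hom.neg]
  and lin_diff = lin_hom[THEN module_hom.diff]
  and lin_sum = lin_hom[THEN module_hom.sum]

lemmas lin_simps = lin_add lin_scale lin_0 lin_neg lin_diff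

lemma lin_comp: "lin S \<Longrightarrow> lin T \<Longrightarrow> lin (\<lambda>x. S (T x))"
  by (rule linI) (simp_all add: lin_simps)

lemma lin_plus: "lin S \<Longrightarrow> lin T \<Longrightarrow> lin (\<lambda>x. S x + T x)"
  by (rule linI) (simp_all add: lin_simps algebra_simps)

lemma lin_minus: "lin S \<Longrightarrow> lin T \<Longrightarrow> lin (\<lambda>x. S x - T x)"
  by (rule linI) (simp_all add: lin_simps algebra_simps)

lemma lin_smult: "lin T \<Longrightarrow> lin (\<lambda>x. c *s T x)"
  by (rule linI) (simp_all add: lin_simps algebra_simps)

lemma lin_id: "lin (\<lambda>x. x)" and lin_zero: "lin (\<lambda>x. 0)"
  by (rule linI; simp)+

lemma lin_setsum: "(\<And>i. i \<in> I \<Longrightarrow> lin (T i)) \<Longrightarrow> lin (\<lambda>x. \<Sum>i\<in>I. T i x)"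
  by (rule linI) (simp_all add: lin_simps sum.distrib scale_sum_right)

lemma lin_funpow: "lin T \<Longrightarrow> lin (T ^^ n)"
proof (induction n)
  case 0
  show ?case using lin_id by (simp add: id_def)
next
  case (Suc n)
  then show ?case using lin_comp[of T "T ^^ n"] by (simp add: o_def)
qed

(* Closure under composition stays out of this list: as an introduction rule it applies to every
   goal, with the identity as one of the factors. *)
lemmas lin_intros = lin_plus lin_minus lin_smult lin_id lin_zero lin_setsum lin_funpow

lemma span_closed:
  assumes "v \<in> span S" "lin T" "subspace W" "\<And>x. x \<in> S \<Longrightarrow> T x \<in> W"
  shows "T v \<in> W"
proof -
  have "span S \<subseteq> {v. T v \<in> W}"
  proof (rule span_minimal)
    show "subspace {v. T v \<in> W}"
      using assms(2,3) by (auto simp: subspace_def lin_simps)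
  qed (use assms(4) in auto)
  then show ?thesis using assms(1) by auto
qed

lemma subspace_basis:
  assumes "subspace W"
  obtains B where "independent B" "span B = W" "finite B" "B \<subseteq> W"
  using assms basis_exists[of W] span_subspace finiteI_independent by metis

lemma representation_lincomb:
  assumes "independent B" "\<And>i. i \<in> I \<Longrightarrow> v i \<in> span B"
  shows "representation B (\<Sum>i\<in>I. c i *s v i) b = (\<Sum>i\<in>I. c i * representation B (v i) b)"
  using assms by (simp add: representation_sum representation_scale span_scale)

text \<open>The trace is taken on invariant subspaces because traces are computed below on the steps of a
  flag and on generalized eigenspaces. The basis is irrelevant by the next lemma.\<close>
definition trace_on :: "'v set \<Rightarrow> ('v \<Rightarrow> 'v) \<Rightarrow> complex"
  where "trace_on W T =
    (let B = (SOME B. independent B \<and> span B = W) in \<Sum>b\<in>B. representation B (T b) b)"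

lemma trace_basis_change:
  assumes B: "independent B" "span B = W" and B': "independent B'" "span B' = W"
    and T: "lin T" "T ` W \<subseteq> W"
  shows "(\<Sum>b\<in>B. representation B (T b) b) = (\<Sum>b\<in>B'. representation B' (T b) b)"
proof -
  note fin = finiteI_independent[OF B(1)] finiteI_independent[OF B'(1)]
  have sub: "B \<subseteq> W" "B' \<subseteq> W" using B B' span_superset by auto
  have "representation B (T b) b = (\<Sum>c\<in>B'. representation B' (T b) c * representation B c b)"
    if "b \<in> B" for b
  proof -
    have "T b \<in> span B'" using that sub T B' by auto
    then have "T b = (\<Sum>c\<in>B'. representation B' (T b) c *s c)"
      using sum_representation_eq[OF B'(1) _ fin(2)] by simp
    then have "representation B (T b) b
        = representation B (\<Sum>c\<in>B'. representation B' (T b) c *s c) b" by simp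
    also have "\<dots> = (\<Sum>c\<in>B'. representation B' (T b) c * representation B c b)"
      by (rule representation_lincomb) (use B sub in auto)
    finally show ?thesis .
  qed
  then have "(\<Sum>b\<in>B. representation B (T b) b)
      = (\<Sum>b\<in>B. \<Sum>c\<in>B'. representation B' (T b) c * representation B c b)" by simp
  also have "\<dots> = (\<Sum>c\<in>B'. \<Sum>b\<in>B. representation B c b * representation B' (T b) c)"
    by (subst sum.swap) (simp add: mult.commute)
  also have "\<dots> = (\<Sum>c\<in>B'. representation B' (T c) c)"
  proof (rule sum.cong[OF refl])
    fix c assume "c \<in> B'"
    then have "c \<in> span B" using sub B by auto
    then have "c = (\<Sum>b\<in>B. representation B c b *s b)"
      using sum_representation_eq[OF B(1) _ fin(1)] by simp
    then have "T c = T (\<Sum>b\<in>B. representation B c b *s b)" by simp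
    also have "\<dots> = (\<Sum>b\<in>B. representation B c b *s T b)"
      using T(1) by (simp add: lin_sum lin_simps)
    finally have "representation B' (T c) c
        = representation B' (\<Sum>b\<in>B. representation B c b *s T b) c" by simp
    also have "\<dots> = (\<Sum>b\<in>B. representation B c b * representation B' (T b) c)"
      by (rule representation_lincomb) (use B' sub T in auto)
    finally show "(\<Sum>b\<in>B. representation B c b * representation B' (T b) c)
        = representation B' (T c) c" by simp
  qed
  finally show ?thesis .
qed

lemma trace_on_basis:
  assumes "independent B" "span B = W" "lin T" "T ` W \<subseteq> W"
  shows "trace_on W T = (\<Sum>b\<in>B. representation B (T b) b)"
proof -
  define C where "C = (SOME C. independent C \<and> span C = W)"
  have "independent C \<and> span C = W"
    unfolding C_def by (rule someI[where x=B]) (use assms in auto)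
  then show ?thesis
    using trace_basis_change[of C W B T] assms by (simp add: trace_on_def C_def Let_def)
qed

lemma trace_on_cong:
  assumes "subspace W" "lin S" "lin T" "S ` W \<subseteq> W" "\<And>v. v \<in> W \<Longrightarrow> S v = T v"
  shows "trace_on W S = trace_on W T"
proof -
  obtain B where B: "independent B" "span B = W" "B \<subseteq> W" using subspace_basis assms(1) by metis
  have "T ` W \<subseteq> W" using assms(4,5) by auto
  then show ?thesis
    using B assms by (simp add: trace_on_basis[OF B(1,2)] subset_iff)
qed

lemma trace_on_add:
  assumes "subspace W" "lin S" "lin T" "S ` W \<subseteq> W" "T ` W \<subseteq> W"
  shows "trace_on W (\<lambda>x. S x + T x) = trace_on W S + trace_on W T"
proof -
  obtain B where B: "independent B" "span B = W" "B \<subseteq> W" using subspace_basis assms(1) by metis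
  have "(\<lambda>x. S x + T x) ` W \<subseteq> W" using assms by (auto intro: subspace_add)
  moreover have "representation B (S b + T b) b = representation B (S b) b + representation B (T b) b"
    if "b \<in> B" for b
  proof -
    have "S b \<in> span B" "T b \<in> span B"
      using that B(2,3) assms(4,5) by (metis image_subset_iff subsetD)+
    then show ?thesis using representation_add[OF B(1)] by simp
  qed
  ultimately show ?thesis
    using B assms by (simp add: trace_on_basis[OF B(1,2)] lin_plus sum.distrib)
qed

lemma trace_on_scale:
  assumes "subspace W" "lin T" "T ` W \<subseteq> W"
  shows "trace_on W (\<lambda>x. c *s T x) = c * trace_on W T"
proof -
  obtain B where B: "independent B" "span B = W" "B \<subseteq> W" using subspace_basis assms(1) by metis
  have "(\<lambda>x. c *s T x) ` W \<subseteq> W" using assms by (auto intro: subspace_scale)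
  moreover have "representation B (c *s T b) b = c * representation B (T b) b" if "b \<in> B" for b
    using representation_scale[OF B(1), of "T b"] that B assms by (auto simp: image_subset_iff)
  ultimately show ?thesis
    using B assms by (simp add: trace_on_basis[OF B(1,2)] lin_smult sum_distrib_left)
qed

lemma trace_on_diff:
  assumes "subspace W" "lin S" "lin T" "S ` W \<subseteq> W" "T ` W \<subseteq> W"
  shows "trace_on W (\<lambda>x. S x - T x) = trace_on W S - trace_on W T"
proof -
  have "(\<lambda>x. (-1) *s T x) ` W \<subseteq> W" using assms by (auto intro: subspace_neg)
  then show ?thesis
    using trace_on_add[of W S "\<lambda>x. (-1) *s T x"] trace_on_scale[of W T "-1"] assms
    by (simp add: lin_smult[of T "-1", simplified])
qed

lemma trace_on_id:
  assumes "subspace W"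
  shows "trace_on W (\<lambda>x. x) = of_nat (dim W)"
proof -
  obtain B where B: "independent B" "span B = W" "B \<subseteq> W" using subspace_basis assms by metis
  have "trace_on W (\<lambda>x. x) = (\<Sum>b\<in>B. representation B b b)"
    by (rule trace_on_basis[OF B(1,2) lin_id]) auto
  also have "\<dots> = (\<Sum>b\<in>B. 1)" by (rule sum.cong) (simp_all add: representation_basis[OF B(1)])
  also have "\<dots> = of_nat (dim W)" using B dim_span_eq_card_independent by force
  finally show ?thesis .
qed

lemma trace_on_zero: "subspace W \<Longrightarrow> trace_on W (\<lambda>x. 0) = 0"
  using trace_on_scale[of W "\<lambda>x. x" 0] by (simp add: lin_id)

lemma trace_on_trivial: "trace_on {0} T = 0"
proof -
  define C where "C = (SOME C. independent C \<and> span C = {0})"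
  have "independent C \<and> span C = {0}"
    unfolding C_def by (rule someI[where x="{}"]) (simp add: independent_empty)
  then have "C = {}" using span_superset[of C] dependent_zero[of C] by auto
  then show ?thesis by (simp add: trace_on_def C_def[symmetric])
qed

lemma trace_on_sum:
  assumes "subspace W" "\<And>i. i \<in> I \<Longrightarrow> lin (T i)" "\<And>i. i \<in> I \<Longrightarrow> T i ` W \<subseteq> W"
  shows "trace_on W (\<lambda>x. \<Sum>i\<in>I. T i x) = (\<Sum>i\<in>I. trace_on W (T i))"
  using assms(2,3)
proof (induction I rule: infinite_finite_induct)
  case (insert i I)
  have "trace_on W (\<lambda>x. T i x + (\<Sum>i\<in>I. T i x)) = trace_on W (T i) + trace_on W (\<lambda>x. \<Sum>i\<in>I. T i x)"
    by (rule trace_on_add) (use insert assms(1) in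
        \<open>auto intro!: lin_setsum subspace_sum simp: image_subset_iff\<close>)
  then show ?case using insert by simp
qed (auto simp: trace_on_zero assms)

lemma trace_on_comm:
  assumes "subspace W" "lin S" "lin T" "S ` W \<subseteq> W" "T ` W \<subseteq> W"
  shows "trace_on W (\<lambda>x. S (T x)) = trace_on W (\<lambda>x. T (S x))"
proof -
  obtain B where B: "independent B" "span B = W" "B \<subseteq> W" "finite B"
    using subspace_basis assms(1) by metis
  have expand: "representation B (P (Q b)) b
      = (\<Sum>c\<in>B. representation B (Q b) c * representation B (P c) b)"
    if "b \<in> B" "lin P" "P ` W \<subseteq> W" "Q ` W \<subseteq> W" for P Q b
  proof -
    have "Q b \<in> span B" using that(1,4) B(2,3) by (metis image_subset_iff subsetD)
    then have "Q b = (\<Sum>c\<in>B. representation B (Q b) c *s c)"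
      using sum_representation_eq[OF B(1) _ B(4)] by simp
    then have "P (Q b) = P (\<Sum>c\<in>B. representation B (Q b) c *s c)" by simp
    also have "\<dots> = (\<Sum>c\<in>B. representation B (Q b) c *s P c)"
      using that by (simp add: lin_sum lin_simps)
    finally have "representation B (P (Q b)) b
        = representation B (\<Sum>c\<in>B. representation B (Q b) c *s P c) b" by simp
    also have "\<dots> = (\<Sum>c\<in>B. representation B (Q b) c * representation B (P c) b)"
      by (rule representation_lincomb) (use B that in auto)
    finally show ?thesis .
  qed
  have "trace_on W (\<lambda>x. S (T x)) = (\<Sum>b\<in>B. representation B (S (T b)) b)"
    by (rule trace_on_basis[OF B(1,2)]) (use assms in \<open>auto intro: lin_comp\<close>)
  also have "\<dots> = (\<Sum>b\<in>B. \<Sum>c\<in>B. representation B (T b) c * representation B (S c) b)"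
    using expand assms by simp
  also have "\<dots> = (\<Sum>b\<in>B. \<Sum>c\<in>B. representation B (S b) c * representation B (T c) b)"
    by (subst sum.swap) (simp add: mult.commute)
  also have "\<dots> = (\<Sum>b\<in>B. representation B (T (S b)) b)"
    using expand assms by simp
  also have "\<dots> = trace_on W (\<lambda>x. T (S x))"
    by (rule trace_on_basis[OF B(1,2), symmetric]) (use assms in \<open>auto intro: lin_comp\<close>)
  finally show ?thesis .
qed

text \<open>Extend a basis of \<open>U\<close> to a basis of \<open>W\<close>: the additional basis vectors contribute no diagonal
  coefficient, because their images are combinations of the basis of \<open>U\<close>.\<close>
lemma trace_on_restrict:
  assumes "subspace W" "subspace U" "U \<subseteq> W" "lin T" "T ` W \<subseteq> U"
  shows "trace_on W T = trace_on U T"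
proof -
  obtain A where A: "independent A" "span A = U" "A \<subseteq> U" using subspace_basis assms(2) by metis
  obtain B where B: "A \<subseteq> B" "B \<subseteq> W" "independent B" "W \<subseteq> span B"
    using maximal_independent_subset_extend[of A W] A assms(3) by blast
  have sB: "span B = W" using B assms(1) span_subspace by metis
  have eq: "representation B (T b) = representation A (T b)" if "b \<in> B" for b
  proof -
    have "T b \<in> span A" using that B(2) A(2) assms(5) by (metis image_subset_iff subsetD)
    then show ?thesis using representation_extend[OF B(3) _ B(1)] by blast
  qed
  have "trace_on W T = (\<Sum>b\<in>B. representation B (T b) b)"
    by (rule trace_on_basis[OF B(3) sB assms(4)]) (use assms in auto)
  also have "\<dots> = (\<Sum>b\<in>B. representation A (T b) b)" using eq by simp
  also have "\<dots> = (\<Sum>b\<in>A. representation A (T b) b)"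
    by (rule sum.mono_neutral_right)
       (use B finiteI_independent representation_ne_zero in blast)+
  also have "\<dots> = trace_on U T"
    by (rule trace_on_basis[OF A(1,2) assms(4), symmetric]) (use assms in auto)
  finally show ?thesis .
qed

text \<open>Strictly triangular operators have trace zero; restricting along the flag removes one step at
  a time.\<close>
lemma trace_on_flag:
  assumes "\<And>i. subspace (W i)" "\<And>i. i < n \<Longrightarrow> W i \<subseteq> W (Suc i)" "W 0 = {0}"
    and "lin T" "\<And>i. i < n \<Longrightarrow> T ` W (Suc i) \<subseteq> W i"
  shows "trace_on (W n) T = 0"
proof -
  have "trace_on (W m) T = 0" if "m \<le> n" for m
    using that
  proof (induction m)
    case 0
    show ?case by (simp add: assms trace_on_trivial)
  next
    case (Suc m)
    then show ?case using trace_on_restrict[of "W (Suc m)" "W m" T] assms by simp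
  qed
  then show ?thesis by simp
qed

section \<open>Eigenvectors and quotients\<close>

lemma funpow_closed: "T ` W \<subseteq> W \<Longrightarrow> v \<in> W \<Longrightarrow> (T ^^ n) v \<in> W"
  by (induction n) auto

text \<open>Otherwise the dimensions of the spans would grow beyond that of the whole space.\<close>
lemma krylov_dependence:
  obtains n where "(T ^^ n) v \<in> span ((\<lambda>j. (T ^^ j) v) ` {..<n})"
proof (rule ccontr)
  assume "\<not> thesis"
  then have new: "(T ^^ n) v \<notin> span ((\<lambda>j. (T ^^ j) v) ` {..<n})" for n using that by blast
  have "dim ((\<lambda>j. (T ^^ j) v) ` {..<n}) = n" for n
    by (induction n) (use new in \<open>simp_all add: lessThan_Suc dim_insert\<close>)
  then show False using dim_subset_UNIV[of "(\<lambda>j. (T ^^ j) v) ` {..<Suc dimension}"] by simp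
qed

lemma span_image_lincomb:
  assumes "x \<in> span (f ` {..<n::nat})"
  obtains c where "x = (\<Sum>j<n. c j *s f j)"
  using assms
proof (induction n arbitrary: x thesis)
  case (Suc n)
  from Suc.prems(2) obtain k where "x - k *s f n \<in> span (f ` {..<n})"
    by (auto simp: lessThan_Suc span_breakdown_eq)
  then obtain c where "x - k *s f n = (\<Sum>j<n. c j *s f j)" using Suc.IH by blast
  then have "x = (\<Sum>j<Suc n. (c(n := k)) j *s f j)"
    by (simp add: algebra_simps)
  then show ?case using Suc.prems(1) by blast
qed auto

text \<open>A linear relation between the iterates \<open>v, T v, \<dots>\<close> is a polynomial in \<open>T\<close> that kills \<open>v\<close>. Splitting
  off its linear factors one by one, the last vector before zero is an eigenvector.\<close>
lemma eigenvector_exists: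
  assumes "subspace W" "W \<noteq> {0}" "lin T" "T ` W \<subseteq> W"
  obtains a v where "v \<in> W" "v \<noteq> 0" "T v = a *s v"
proof -
  obtain v where v: "v \<in> W" "v \<noteq> 0" using assms(1,2) subspace_0 by blast
  define ev where "ev N p = (\<Sum>i\<le>N. coeff p i *s (T ^^ i) v)" for N p
  have evW: "ev N p \<in> W" for N p
    unfolding ev_def using assms v
    by (intro subspace_sum subspace_scale funpow_closed) auto
  have main: "\<exists>a v. v \<in> W \<and> v \<noteq> 0 \<and> T v = a *s v"
    if "p \<noteq> 0" "ev N p = 0" "degree p \<le> N" for p N
    using that
  proof (induction "degree p" arbitrary: p N)
    case 0
    then obtain c where c: "p = [:c:]" "c \<noteq> 0" by (metis degree_eq_zeroE pCons_0_0)
    have "ev N p = (\<Sum>i\<in>{0}. coeff p i *s (T ^^ i) v)"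
      unfolding ev_def by (rule sum.mono_neutral_right) (auto simp: c coeff_pCons split: nat.splits)
    then show ?case using c v "0.prems" by simp
  next
    case (Suc n)
    have "\<not> constant (poly p)" using Suc(2) by (simp add: constant_degree)
    then obtain a where "poly p a = 0" using fundamental_theorem_of_algebra by blast
    then obtain q where q: "p = [:-a, 1:] * q" by (meson dvdE poly_eq_0_iff_dvd)
    have q0: "q \<noteq> 0" using q Suc.prems by auto
    have dq: "degree p = Suc (degree q)"
      unfolding q using degree_mult_eq[of "[:-a, 1:]" q] q0 by (simp del: mult_pCons_left)
    obtain M where M: "N = Suc M" "degree q \<le> M" using Suc.prems(3) dq by (cases N) auto
    have split: "ev N r = coeff r 0 *s v + (\<Sum>i\<le>M. coeff r (Suc i) *s (T ^^ Suc i) v)" for r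
      unfolding ev_def M(1) by (subst sum.atMost_Suc_shift) simp
    have "coeff q (Suc M) = 0" using M(2) by (simp add: coeff_eq_0)
    then have "ev N q = ev M q" by (simp add: ev_def M(1))
    moreover have "T (ev M q) = (\<Sum>i\<le>M. coeff q i *s (T ^^ Suc i) v)"
      unfolding ev_def using assms(3) by (simp add: lin_sum lin_simps)
    moreover have "ev N p = (\<Sum>i\<le>M. coeff q i *s (T ^^ Suc i) v) - a *s ev N q"
      unfolding split unfolding q
      by (simp add: algebra_simps sum.distrib sum_subtractf scale_sum_right)
    ultimately have T: "T (ev M q) = a *s ev M q" using Suc.prems(2) by simp
    show ?case
    proof (cases "ev M q = 0")
      case True
      then show ?thesis using Suc.hyps q0 M dq by (metis nat.inject)
    qed (use T evW in blast)
  qed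
  obtain n where "(T ^^ n) v \<in> span ((\<lambda>j. (T ^^ j) v) ` {..<n})" using krylov_dependence .
  then obtain c where c: "(T ^^ n) v = (\<Sum>j<n. c j *s (T ^^ j) v)"
    using span_image_lincomb[of _ "\<lambda>j. (T ^^ j) v"] by blast
  define p where "p = monom 1 n - (\<Sum>j<n. monom (c j) j)"
  have cp: "coeff p i = (if i = n then 1 else if i < n then - c i else 0)" for i
    by (auto simp: p_def coeff_sum)
  have "p \<noteq> 0" using cp[of n] by auto
  moreover have "degree p \<le> n" by (rule degree_le) (auto simp: cp)
  moreover have "ev n p = 0"
  proof -
    have "ev n p = (\<Sum>i<n. coeff p i *s (T ^^ i) v) + coeff p n *s (T ^^ n) v"
      by (simp add: ev_def lessThan_Suc_atMost[symmetric])
    then show ?thesis using c by (simp add: cp sum_negf)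
  qed
  ultimately show thesis using main that by blast
qed

lemma projection_along:
  assumes M: "subspace M" and N: "subspace N" and "M \<inter> N = {0}"
    and full: "\<And>v. \<exists>x\<in>M. \<exists>y\<in>N. v = x + y"
  obtains P where "lin P" "\<And>v. v \<in> M \<Longrightarrow> P v = v" "\<And>v. v \<in> N \<Longrightarrow> P v = 0"
    "\<And>v. P v \<in> M"
proof -
  have uniq: "x = x'" if "x + y = x' + y'" "x \<in> M" "x' \<in> M" "y \<in> N" "y' \<in> N" for x x' y y'
  proof -
    have "x - x' = y' - y" using that(1) by (metis add_diff_cancel_left' add_diff_eq diff_add_eq diff_diff_eq2)
    then have "x - x' \<in> M \<inter> N" using that M N by (auto intro: subspace_diff) (metis subspace_diff)
    then show ?thesis using assms(3) by auto
  qed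
  define P where "P v = (SOME x. x \<in> M \<and> (\<exists>y\<in>N. v = x + y))" for v
  have P: "P v \<in> M \<and> (\<exists>y\<in>N. v = P v + y)" for v
    unfolding P_def by (rule someI_ex) (use full in blast)
  have Peq: "P (x + y) = x" if "x \<in> M" "y \<in> N" for x y
    using P[of "x + y"] uniq that by metis
  have "lin P"
  proof (rule linI)
    fix v w
    obtain y z where y: "y \<in> N" "v = P v + y" "z \<in> N" "w = P w + z" using P by blast
    have "v + w = (P v + P w) + (y + z)" using y by (metis add.assoc add.left_commute)
    then show "P (v + w) = P v + P w"
      using Peq[of "P v + P w" "y + z"] y P M N by (simp add: subspace_add)
  next
    fix c v
    obtain y where y: "y \<in> N" "v = P v + y" using P by blast
    then have "c *s v = c *s P v + c *s y" by (metis scale_right_distrib)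
    then show "P (c *s v) = c *s P v"
      using Peq[of "c *s P v" "c *s y"] y P M N by (simp add: subspace_scale)
  qed
  moreover have "P v = v" if "v \<in> M" for v using Peq[of v 0] that N subspace_0 by auto
  moreover have "P v = 0" if "v \<in> N" for v using Peq[of 0 v] that M subspace_0 by auto
  ultimately show thesis using that P by blast
qed

lemma complement_exists:
  assumes M: "subspace M"
  obtains C where "subspace C" "C \<inter> M = {0}" "\<And>v. \<exists>x\<in>C. \<exists>y\<in>M. v = x + y"
proof -
  obtain A where A: "independent A" "span A = M" using subspace_basis M by metis
  obtain B where B: "A \<subseteq> B" "independent B" "UNIV \<subseteq> span B"
    using maximal_independent_subset_extend[of A UNIV] A by auto
  have fin: "finite B" using B finiteI_independent by blast
  show thesis
  proof
    show "subspace (span (B - A))" by simp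
    show "\<exists>x\<in>span (B - A). \<exists>y\<in>M. v = x + y" for v
    proof -
      have "v \<in> span ((B - A) \<union> A)" using B by (metis Un_Diff_cancel2 subset_Un_eq Un_commute UNIV_I subsetD)
      then show ?thesis unfolding span_Un A(2) by auto
    qed
    have "v = 0" if v: "v \<in> span (B - A)" "v \<in> span A" for v
    proof -
      have "representation B v b = 0" for b
        using representation_extend[OF B(2) v(1)] representation_extend[OF B(2) v(2) B(1)]
        by (metis Diff_iff Diff_subset representation_ne_zero)
      then show "v = 0"
        using sum_representation_eq[OF B(2) _ fin, of v] B(3) by auto
    qed
    then show "span (B - A) \<inter> M = {0}" using A(2) span_zero by auto
  qed
qed

text \<open>The quotient by \<open>M\<close> is represented by the range of a projection \<open>P\<close> with kernel \<open>M\<close>. An operator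
  \<open>T\<close> that preserves \<open>M\<close> then induces \<open>P \<circ> T\<close> on the quotient, so that statements about modules
  carried by subspaces also cover quotient modules.\<close>
lemma quotient_projection:
  assumes M: "subspace M"
  obtains P where "lin P" "\<And>v. P v = 0 \<longleftrightarrow> v \<in> M" "\<And>v. v - P v \<in> M" "\<And>v. P (P v) = P v"
proof -
  obtain C where C: "subspace C" "C \<inter> M = {0}" "\<And>v. \<exists>x\<in>C. \<exists>y\<in>M. v = x + y"
    using complement_exists M by metis
  obtain P where P: "lin P" "\<And>v. v \<in> C \<Longrightarrow> P v = v" "\<And>v. v \<in> M \<Longrightarrow> P v = 0" "\<And>v. P v \<in> C"
    using projection_along[OF C(1) M C(2,3)] by metis
  have diff: "v - P v \<in> M" for v
  proof -
    obtain x y where "x \<in> C" "y \<in> M" "v = x + y" using C(3) by blast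
    then show ?thesis using P by (simp add: lin_simps)
  qed
  show thesis
  proof
    show "P v = 0 \<longleftrightarrow> v \<in> M" for v using diff[of v] P(3) by auto
  qed (use P diff in auto)
qed

lemma eigenvector_mod:
  assumes "subspace M" "M \<noteq> UNIV" "lin T"
  obtains a v where "v \<notin> M" "T v - a *s v \<in> M"
proof -
  obtain P where P: "lin P" "\<And>v. P v = 0 \<longleftrightarrow> v \<in> M" "\<And>v. v - P v \<in> M" "\<And>v. P (P v) = P v"
    using quotient_projection assms(1) by metis
  have "subspace (range P)" using P(1) lin_hom module_hom.subspace_image subspace_UNIV by blast
  moreover have "range P \<noteq> {0}" using assms(2) P(2) by auto
  moreover have "lin (\<lambda>x. P (T x))" using P(1) assms(3) by (rule lin_comp)
  moreover have "(\<lambda>x. P (T x)) ` range P \<subseteq> range P" by auto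
  ultimately obtain a v where v: "v \<in> range P" "v \<noteq> 0" "P (T v) = a *s v"
    by (rule eigenvector_exists)
  then have Pv: "P v = v" using P(4) by auto
  have "P (T v - a *s v) = 0" using v Pv P(1) by (simp add: lin_simps)
  then show thesis using that[of v a] v Pv P(2) by metis
qed

lemma injective_endomorphism_onto:
  assumes S: "lin S" and B: "subspace B" and "S ` B \<subseteq> B" "\<And>u. u \<in> B \<Longrightarrow> S u = 0 \<Longrightarrow> u = 0"
  shows "S ` B = B"
proof -
  interpret pr: finite_dimensional_vector_space_pair_1 scale basis scale ..
  have "inj_on S B"
    using assms(4) subspace_diff[OF B] lin_diff[OF S] by (intro inj_onI) (metis eq_iff_diff_eq_0)
  then have "dim (S ` B) = dim B"
    using pr.dim_image_eq[OF S, of B] B by (metis span_eq_iff)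
  moreover have "subspace (S ` B)" using module_hom.subspace_image[OF lin_hom[OF S] B] .
  ultimately show ?thesis using subspace_dim_equal B assms(3) by (metis order_refl)
qed

section \<open>Generalized eigenspaces\<close>

definition gen_eigenspace :: "('v \<Rightarrow> 'v) \<Rightarrow> complex \<Rightarrow> 'v set"
  where "gen_eigenspace T a = {v. \<exists>m. ((\<lambda>x. T x - a *s x) ^^ m) v = 0}"

lemma lin_shift: "lin T \<Longrightarrow> lin (\<lambda>x. T x - a *s x)"
  by (intro lin_intros)

lemma funpow_zero_mono:
  assumes "lin S" "(S ^^ m) v = 0" "m \<le> n"
  shows "(S ^^ n) v = 0"
proof -
  have "(S ^^ ((n - m) + m)) v = (S ^^ (n - m)) ((S ^^ m) v)" unfolding funpow_add by simp
  then show ?thesis using assms lin_0[OF lin_funpow[OF assms(1)]] by simp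
qed

lemma subspace_gen_eigenspace:
  assumes "lin T"
  shows "subspace (gen_eigenspace T a)"
proof -
  let ?S = "\<lambda>x. T x - a *s x"
  note S = lin_shift[OF assms, of a]
  note pow = lin_funpow[OF S]
  show ?thesis
  proof (rule subspaceI)
    fix x y assume "x \<in> gen_eigenspace T a" "y \<in> gen_eigenspace T a"
    then obtain m n where "(?S ^^ m) x = 0" "(?S ^^ n) y = 0" by (auto simp: gen_eigenspace_def)
    then have "(?S ^^ (max m n)) x = 0" "(?S ^^ (max m n)) y = 0"
      using funpow_zero_mono[OF S] by (meson max.cobounded1 max.cobounded2)+
    then have "(?S ^^ (max m n)) (x + y) = 0" by (simp add: lin_add[OF pow])
    then show "x + y \<in> gen_eigenspace T a" unfolding gen_eigenspace_def by blast
  next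
    fix c x assume "x \<in> gen_eigenspace T a"
    then obtain m where "(?S ^^ m) x = 0" by (auto simp: gen_eigenspace_def)
    then have "(?S ^^ m) (c *s x) = 0" by (simp add: lin_scale[OF pow])
    then show "c *s x \<in> gen_eigenspace T a" unfolding gen_eigenspace_def by blast
  qed (auto simp: gen_eigenspace_def lin_0[OF pow])
qed

lemma gen_eigenspace_closed:
  assumes "lin T" "v \<in> gen_eigenspace T a"
  shows "T v \<in> gen_eigenspace T a" "T v - b *s v \<in> gen_eigenspace T a"
proof -
  let ?S = "\<lambda>x. T x - a *s x"
  obtain m where m: "(?S ^^ m) v = 0" using assms(2) by (auto simp: gen_eigenspace_def)
  have "(?S ^^ m) (?S v) = ?S ((?S ^^ m) v)"
    by (rule funpow_swap1[symmetric])
  also have "\<dots> = 0" using m assms(1) by (simp add: lin_0)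
  finally have Sv: "?S v \<in> gen_eigenspace T a" by (auto simp: gen_eigenspace_def)
  note sub = subspace_gen_eigenspace[OF assms(1)]
  have "?S v + a *s v \<in> gen_eigenspace T a"
    by (intro subspace_add[OF sub] subspace_scale[OF sub] Sv assms(2))
  then show T: "T v \<in> gen_eigenspace T a" by simp
  show "T v - b *s v \<in> gen_eigenspace T a"
    using T assms(2) sub subspace_diff subspace_scale by blast
qed

lemma eigenvector_in_gen_eigenspace:
  assumes "lin T" "v \<in> gen_eigenspace T a" "T v = b *s v" "b \<noteq> a"
  shows "v = 0"
proof -
  obtain m where m: "((\<lambda>x. T x - a *s x) ^^ m) v = 0"
    using assms(2) by (auto simp: gen_eigenspace_def)
  have "((\<lambda>x. T x - a *s x) ^^ m) v = (b - a) ^ m *s v"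
  proof (induction m)
    case (Suc m)
    have "((\<lambda>x. T x - a *s x) ^^ Suc m) v = T ((b - a) ^ m *s v) - a *s (b - a) ^ m *s v"
      using Suc by simp
    also have "\<dots> = (b - a) ^ Suc m *s v"
      using assms(1,3) by (simp add: lin_simps algebra_simps)
    finally show ?case .
  qed simp
  then show ?thesis using m assms(4) by simp
qed

lemma shift_onto_gen_eigenspace:
  assumes T: "lin T" and "b \<noteq> a" and v: "v \<in> gen_eigenspace T b"
  obtains u where "u \<in> gen_eigenspace T b" "T u - a *s u = v"
proof -
  let ?G = "gen_eigenspace T b" and ?S = "\<lambda>x. T x - a *s x"
  have "?S ` ?G = ?G"
  proof (rule injective_endomorphism_onto[OF lin_shift[OF T] subspace_gen_eigenspace[OF T]])
    show "?S ` ?G \<subseteq> ?G" using gen_eigenspace_closed(2)[OF T] by blast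
    show "u = 0" if "u \<in> ?G" "?S u = 0" for u
      using eigenvector_in_gen_eigenspace[OF T that(1), of a] that(2) assms(2) by simp
  qed
  then show thesis using v that by (metis (no_types, lifting) imageE)
qed

text \<open>If the generalized eigenspaces spanned a proper subspace \<open>M\<close>, there would be an eigenvector \<open>v\<close>
  modulo \<open>M\<close>, with eigenvalue \<open>a\<close> say. As \<open>T - a\<close> is onto on all the other generalized eigenspaces,
  \<open>v\<close> can be changed by an element of \<open>M\<close> such that \<open>(T - a) v\<close> lies in the one for \<open>a\<close>. But then
  so does \<open>v\<close>.\<close>
lemma gen_eigenspaces_span:
  assumes T: "lin T"
  shows "span (\<Union>a. gen_eigenspace T a) = UNIV"
proof (rule ccontr)
  let ?M = "span (\<Union>a. gen_eigenspace T a)"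
  assume "?M \<noteq> UNIV"
  then obtain a v where v: "v \<notin> ?M" "T v - a *s v \<in> ?M"
    using eigenvector_mod[of ?M T] T subspace_span by metis
  define Q where "Q = {x + (T u - a *s u) | x u. x \<in> gen_eigenspace T a \<and> u \<in> ?M}"
  have "?M \<subseteq> Q"
  proof (rule span_minimal)
    have "subspace {T u - a *s u | u. u \<in> ?M}"
      using module_hom.subspace_image[OF lin_hom[OF lin_shift[OF T, of a]], of ?M]
      by (simp add: image_def Setcompr_eq_image)
    then have "subspace {x + y | x y. x \<in> gen_eigenspace T a \<and> y \<in> {T u - a *s u | u. u \<in> ?M}}"
      using subspace_sums subspace_gen_eigenspace[OF T] by blast
    moreover have "{x + y | x y. x \<in> gen_eigenspace T a \<and> y \<in> {T u - a *s u | u. u \<in> ?M}} = Q"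
      unfolding Q_def by blast
    ultimately show "subspace Q" by simp
    show "(\<Union>a. gen_eigenspace T a) \<subseteq> Q"
    proof
      fix w assume "w \<in> (\<Union>a. gen_eigenspace T a)"
      then obtain b where b: "w \<in> gen_eigenspace T b" by blast
      show "w \<in> Q"
      proof (cases "b = a")
        case True
        then have "w = w + (T 0 - a *s 0)" using T by (simp add: lin_0)
        then show ?thesis unfolding Q_def using b True span_zero by blast
      next
        case False
        then obtain u where "u \<in> gen_eigenspace T b" "T u - a *s u = w"
          using shift_onto_gen_eigenspace[OF T] b by metis
        then have "w = 0 + (T u - a *s u)" "u \<in> ?M" by (auto intro: span_base)
        then show ?thesis unfolding Q_def using subspace_0[OF subspace_gen_eigenspace[OF T]] by blast
      qed
    qed
  qed
  then obtain x u where xu: "x \<in> gen_eigenspace T a" "u \<in> ?M" "T v - a *s v = x + (T u - a *s u)"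
    using v(2) unfolding Q_def by blast
  then have x: "T (v - u) - a *s (v - u) = x" using T by (simp add: lin_simps algebra_simps)
  obtain m where "((\<lambda>x. T x - a *s x) ^^ m) x = 0" using xu(1) by (auto simp: gen_eigenspace_def)
  then have "((\<lambda>x. T x - a *s x) ^^ Suc m) (v - u) = 0" using x by (simp only: funpow_Suc_right comp_apply)
  then have "v - u \<in> gen_eigenspace T a" unfolding gen_eigenspace_def by blast
  then have "v - u \<in> ?M" by (intro span_base) blast
  then have "(v - u) + u \<in> ?M" using xu(2) span_add by blast
  then show False using v(1) by simp
qed

lemma gen_eigenspace_power:
  assumes T: "lin T"
  obtains n where "gen_eigenspace T a = {v. ((\<lambda>x. T x - a *s x) ^^ n) v = 0}"
proof -
  let ?S = "\<lambda>x. T x - a *s x"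
  note S = lin_shift[OF T, of a]
  obtain B where B: "independent B" "span B = gen_eigenspace T a" "finite B" "B \<subseteq> gen_eigenspace T a"
    using subspace_basis subspace_gen_eigenspace[OF T] by metis
  then have "\<forall>b\<in>B. \<exists>m. (?S ^^ m) b = 0" by (auto simp: gen_eigenspace_def)
  then obtain m where m: "\<And>b. b \<in> B \<Longrightarrow> (?S ^^ m b) b = 0" by metis
  define n where "n = (\<Sum>b\<in>B. m b)"
  have "B \<subseteq> {v. (?S ^^ n) v = 0}"
    using funpow_zero_mono[OF S m] B(3) by (auto simp: n_def intro: member_le_sum)
  then have "gen_eigenspace T a \<subseteq> {v. (?S ^^ n) v = 0}"
    using B(2) span_minimal module_hom.subspace_kernel[OF lin_hom[OF lin_funpow[OF S]]] by metis
  then show thesis using that by (auto simp: gen_eigenspace_def)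
qed

text \<open>\<open>T - a\<close> is strictly triangular for the flag of the kernels of its powers.\<close>
lemma trace_on_gen_eigenspace:
  assumes T: "lin T"
  shows "trace_on (gen_eigenspace T a) T = a * of_nat (dim (gen_eigenspace T a))"
proof -
  let ?S = "\<lambda>x. T x - a *s x" and ?G = "gen_eigenspace T a"
  note S = lin_shift[OF T, of a] and G = subspace_gen_eigenspace[OF T, of a]
  obtain n where n: "?G = {v. (?S ^^ n) v = 0}" using gen_eigenspace_power[OF T] .
  have "trace_on {v. (?S ^^ n) v = 0} ?S = 0"
  proof (rule trace_on_flag[where W="\<lambda>i. {v. (?S ^^ i) v = 0}"])
    show "subspace {v. (?S ^^ i) v = 0}" for i
      using module_hom.subspace_kernel[OF lin_hom[OF lin_funpow[OF S]]] .
    show "{v. (?S ^^ i) v = 0} \<subseteq> {v. (?S ^^ Suc i) v = 0}" for i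
      using lin_0[OF S] by auto
    show "?S ` {v. (?S ^^ Suc i) v = 0} \<subseteq> {v. (?S ^^ i) v = 0}" for i
      by (auto simp: funpow_Suc_right simp del: funpow.simps)
  qed (use S in auto)
  then have "trace_on ?G ?S = 0" using n by simp
  moreover have "trace_on ?G ?S = trace_on ?G T - trace_on ?G (\<lambda>x. a *s x)"
    by (rule trace_on_diff[OF G T lin_smult[OF lin_id]])
       (use gen_eigenspace_closed[OF T] subspace_scale[OF G] in auto)
  moreover have "trace_on ?G (\<lambda>x. a *s x) = a * of_nat (dim ?G)"
    using trace_on_scale[OF G lin_id, of a] trace_on_id[OF G] by simp
  ultimately show ?thesis by simp
qed

text \<open>\<open>Y\<close> is \<open>f\<close> applied to the semisimple part of \<open>T\<close>: it multiplies each generalized eigenspace by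
  the value of \<open>f\<close> at the eigenvalue. It is a combination of the projections along the
  decomposition into generalized eigenspaces.\<close>
lemma spectral_function:
  assumes T: "lin T"
  obtains E where "finite E" "span (\<Union>a\<in>E. gen_eigenspace T a) = UNIV"
    "\<And>f. \<exists>Y. lin Y \<and> (\<forall>a. \<forall>v\<in>gen_eigenspace T a. Y v = f a *s v) \<and>
        trace_on UNIV (\<lambda>x. Y (T x)) = (\<Sum>a\<in>E. f a * (a * of_nat (dim (gen_eigenspace T a))))"
proof -
  let ?G = "gen_eigenspace T"
  note G = subspace_gen_eigenspace[OF T]
  obtain B where B: "B \<subseteq> (\<Union>a. ?G a)" "independent B" "(\<Union>a. ?G a) \<subseteq> span B"
    using maximal_independent_subset by metis
  then obtain e where e: "\<And>b. b \<in> B \<Longrightarrow> b \<in> ?G (e b)" by (metis UN_E subsetD)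
  define E where "E = e ` B"
  have finE: "finite E" using B(2) finiteI_independent E_def by blast
  have "span (\<Union>a. ?G a) \<subseteq> span B" using B(3) span_minimal by simp
  moreover have "span B \<subseteq> span (\<Union>a\<in>E. ?G a)" using e by (intro span_mono) (auto simp: E_def)
  ultimately have spE: "span (\<Union>a\<in>E. ?G a) = UNIV" using gen_eigenspaces_span[OF T] by auto
  define H where "H a = span (\<Union>b\<in>-{a}. ?G b)" for a
  have sub: "subspace (H a)" for a by (simp add: H_def)
  have inter: "?G a \<inter> H a = {0}" for a
  proof -
    let ?S = "\<lambda>x. T x - a *s x"
    note S = lin_shift[OF T, of a]
    have into: "?S ` H a \<subseteq> H a"
    proof (rule image_subsetI)
      fix v assume v: "v \<in> H a"
      have "?S x \<in> H a" if "x \<in> (\<Union>b\<in>-{a}. ?G b)" for x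
        using that gen_eigenspace_closed(2)[OF T, of x _ a] unfolding H_def by (intro span_base) auto
      then show "?S v \<in> H a" using span_closed[OF _ S sub] v unfolding H_def by blast
    qed
    (* On the sum of the other generalized eigenspaces T - a is onto, hence injective by
       dimension, so no nonzero vector of that sum is killed by a power of T - a. *)
    have "H a \<subseteq> ?S ` H a"
      unfolding H_def
    proof (rule span_minimal)
      show "subspace (?S ` span (\<Union>b\<in>-{a}. ?G b))"
        using module_hom.subspace_image[OF lin_hom[OF S]] by simp
      show "(\<Union>b\<in>-{a}. ?G b) \<subseteq> ?S ` span (\<Union>b\<in>-{a}. ?G b)"
      proof
        fix w assume "w \<in> (\<Union>b\<in>-{a}. ?G b)"
        then obtain b where b: "b \<noteq> a" "w \<in> ?G b" by auto
        then obtain u where "u \<in> ?G b" "?S u = w" using shift_onto_gen_eigenspace[OF T] by metis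
        then show "w \<in> ?S ` span (\<Union>b\<in>-{a}. ?G b)" using b by (auto intro!: image_eqI[of _ _ u] span_base)
      qed
    qed
    then have img: "?S ` H a = H a" using into by blast
    obtain A where A: "independent A" "span A = H a" "finite A" "A \<subseteq> H a" using subspace_basis sub by metis
    have spA: "span (?S ` A) = H a" using module_hom.span_image[OF lin_hom[OF S], of A] A(2) img by simp
    have cA: "card A = dim (H a)" using A dim_span_eq_card_independent by metis
    have cSA: "card (?S ` A) = card A"
      using card_image_le[OF A(3)] dim_le_card[of "H a" "?S ` A"] spA A(3) cA by (metis finite_imageI le_antisym order_refl)
    then have "inj_on ?S A" using A(3) by (simp add: eq_card_imp_inj_on)
    moreover have "independent (?S ` A)"
      using card_eq_dim[of "?S ` A" "H a"] cSA cA A spA span_superset[of "?S ` A"] by simp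
    ultimately have inj: "inj_on ?S (H a)"
      using module_hom.inj_on_span_iff_independent_image[OF lin_hom[OF S]] A(2) by metis
    have "v = 0" if "(?S ^^ m) v = 0" "v \<in> H a" for m v
      using that
    proof (induction m arbitrary: v)
      case (Suc m)
      then have "?S v = 0" using into by (metis (no_types, lifting) comp_apply funpow_Suc_right image_subset_iff)
      moreover have "?S 0 = 0" using lin_0[OF S] .
      ultimately show ?case using inj Suc.prems(2) subspace_0[OF sub] by (metis (no_types, lifting) inj_onD)
    qed simp
    then show ?thesis using subspace_0[OF G] subspace_0[OF sub] by (auto simp: gen_eigenspace_def)
  qed
  have full: "\<exists>x\<in>?G a. \<exists>y\<in>H a. v = x + y" for a v
  proof -
    have "?G a \<union> (\<Union>b\<in>-{a}. ?G b) = (\<Union>b. ?G b)" by auto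
    then have "v \<in> span (?G a \<union> (\<Union>b\<in>-{a}. ?G b))"
      using gen_eigenspaces_span[OF T] by simp
    moreover have "span (?G a) = ?G a" using G by simp
    ultimately show ?thesis unfolding span_Un H_def by auto
  qed
  have "\<exists>P. lin P \<and> (\<forall>v\<in>?G a. P v = v) \<and> (\<forall>v\<in>H a. P v = 0) \<and> (\<forall>v. P v \<in> ?G a)" for a
    using projection_along[OF G sub inter full, of a] by metis
  then obtain P where P: "\<And>a. lin (P a)" "\<And>a v. v \<in> ?G a \<Longrightarrow> P a v = v"
    "\<And>a v. v \<in> H a \<Longrightarrow> P a v = 0" "\<And>a v. P a v \<in> ?G a" by metis
  have Pother: "P a v = 0" if "v \<in> ?G b" "b \<noteq> a" for a b v
    using P(3)[of v a] that by (auto simp: H_def intro: span_base)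
  have outside: "v = 0" if "a \<notin> E" "v \<in> ?G a" for a v
  proof -
    have "span (\<Union>a\<in>E. ?G a) \<subseteq> H a" unfolding H_def using that by (intro span_mono) auto
    then show ?thesis using that inter spE by auto
  qed
  have "\<exists>Y. lin Y \<and> (\<forall>a. \<forall>v\<in>?G a. Y v = f a *s v) \<and>
        trace_on UNIV (\<lambda>x. Y (T x)) = (\<Sum>a\<in>E. f a * (a * of_nat (dim (?G a))))" for f
  proof (intro exI conjI allI ballI)
    let ?Y = "\<lambda>x. \<Sum>a\<in>E. f a *s P a x"
    show "lin ?Y" by (intro lin_intros P)
    show "?Y v = f a *s v" if v: "v \<in> ?G a" for a v
    proof (cases "a \<in> E")
      case True
      have "?Y v = (\<Sum>b\<in>E. if b = a then f a *s v else 0)"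
        by (rule sum.cong) (use v P(2) Pother in auto)
      then show ?thesis using True finE by simp
    next
      case False
      then have "v = 0" using outside v by blast
      then show ?thesis by (simp add: lin_0[OF P(1)])
    qed
    have "trace_on UNIV (\<lambda>x. ?Y (T x)) = (\<Sum>a\<in>E. trace_on UNIV (\<lambda>x. f a *s P a (T x)))"
      by (rule trace_on_sum) (auto intro!: lin_intros lin_comp[OF P(1) T])
    also have "\<dots> = (\<Sum>a\<in>E. f a * trace_on UNIV (\<lambda>x. P a (T x)))"
      by (rule sum.cong[OF refl], rule trace_on_scale) (auto intro!: lin_intros lin_comp[OF P(1) T])
    also have "\<dots> = (\<Sum>a\<in>E. f a * trace_on (?G a) T)"
    proof (rule sum.cong[OF refl])
      fix a
      have l: "lin (\<lambda>x. P a (T x))" by (rule lin_comp[OF P(1) T])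
      have "trace_on UNIV (\<lambda>x. P a (T x)) = trace_on (?G a) (\<lambda>x. P a (T x))"
        by (rule trace_on_restrict) (use G P(4) l in auto)
      also have "\<dots> = trace_on (?G a) T"
        by (rule trace_on_cong) (use G P l T gen_eigenspace_closed[OF T] in auto)
      finally show "f a * trace_on UNIV (\<lambda>x. P a (T x)) = f a * trace_on (?G a) T" by simp
    qed
    finally show "trace_on UNIV (\<lambda>x. ?Y (T x)) = (\<Sum>a\<in>E. f a * (a * of_nat (dim (?G a))))"
      by (simp add: trace_on_gen_eigenspace[OF T])
  qed
  then show thesis using that finE spE by blast
qed

text \<open>For \<open>f = cnj\<close> the trace in the previous lemma is the sum of the squared absolute values of the
  eigenvalues with multiplicity. Conjugation is chosen because it is also additive, which
  \<open>cartan_nilpotent\<close> exploits.\<close>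
lemma nilpotent_if_conjugate_trace_zero:
  assumes T: "lin T"
    and zero: "\<And>Y. lin Y \<Longrightarrow> (\<And>a v. v \<in> gen_eigenspace T a \<Longrightarrow> Y v = cnj a *s v) \<Longrightarrow>
      trace_on UNIV (\<lambda>x. Y (T x)) = 0"
  shows "gen_eigenspace T 0 = UNIV"
proof -
  note G = subspace_gen_eigenspace[OF T]
  obtain E where E: "finite E" "span (\<Union>a\<in>E. gen_eigenspace T a) = UNIV"
    "\<And>f. \<exists>Y. lin Y \<and> (\<forall>a. \<forall>v\<in>gen_eigenspace T a. Y v = f a *s v) \<and>
        trace_on UNIV (\<lambda>x. Y (T x)) = (\<Sum>a\<in>E. f a * (a * of_nat (dim (gen_eigenspace T a))))"
    using spectral_function[OF T] by blast
  have "(\<Sum>a\<in>E. cnj a * (a * of_nat (dim (gen_eigenspace T a)))) = 0"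
    using E(3)[of cnj] zero by metis
  moreover have "cnj a * (a * of_nat n) = complex_of_real ((cmod a)\<^sup>2 * real n)" for a n
    using complex_norm_square[of a] by simp
  ultimately have "complex_of_real (\<Sum>a\<in>E. (cmod a)\<^sup>2 * real (dim (gen_eigenspace T a))) = 0"
    by simp
  then have "(\<Sum>a\<in>E. (cmod a)\<^sup>2 * real (dim (gen_eigenspace T a))) = 0"
    using of_real_eq_0_iff by blast
  then have "\<forall>a\<in>E. (cmod a)\<^sup>2 * real (dim (gen_eigenspace T a)) = 0"
    using E(1) by (subst (asm) sum_nonneg_eq_0_iff) auto
  then have "gen_eigenspace T a \<subseteq> {0}" if "a \<in> E" "a \<noteq> 0" for a
    using that by auto
  then have "(\<Union>a\<in>E. gen_eigenspace T a) \<subseteq> gen_eigenspace T 0"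
    using subspace_0[OF G, of 0] by fastforce
  then have "span (\<Union>a\<in>E. gen_eigenspace T a) \<subseteq> gen_eigenspace T 0"
    using span_minimal G by blast
  then show ?thesis using E(2) by auto
qed

section \<open>Flags and dual bases\<close>

text \<open>The invariance lemma behind Lie's theorem, with the commutator \<open>[X, \<rho> k]\<close> written as
  \<open>\<rho> (\<delta> k)\<close>; below, \<open>\<delta>\<close> is the adjoint action of an element or an arbitrary derivation. On the span
  of \<open>w, X w, X\<^sup>2 w, \<dots>\<close> every \<open>\<rho> k\<close> is triangular with the constant diagonal \<open>\<omega> k\<close>. Hence the trace of
  \<open>\<rho> (\<delta> k)\<close> is a nonzero multiple of \<open>\<omega> (\<delta> k)\<close>, while it vanishes as the trace of a commutator.\<close>
lemma weight_vanishes_on_commutators: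
  assumes C: "subspace C" and X: "lin X" "X ` C \<subseteq> C"
    and \<rho>: "\<And>k. k \<in> K \<Longrightarrow> lin (\<rho> k)" "\<And>k. k \<in> K \<Longrightarrow> \<rho> k ` C \<subseteq> C"
    and \<delta>: "\<And>k. k \<in> K \<Longrightarrow> \<delta> k \<in> K"
      "\<And>k v. k \<in> K \<Longrightarrow> v \<in> C \<Longrightarrow> \<rho> (\<delta> k) v = X (\<rho> k v) - \<rho> k (X v)"
    and w: "w \<in> C" "w \<noteq> 0" "\<And>k. k \<in> K \<Longrightarrow> \<rho> k w = \<omega> k *s w"
    and k: "k \<in> K"
  shows "\<omega> (\<delta> k) = 0"
proof -
  define x where "x j = (X ^^ j) w" for j
  define U where "U i = span (x ` {..<i})" for i
  have xC: "x j \<in> C" for j unfolding x_def using X w by (intro funpow_closed)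
  have UC: "U i \<subseteq> C" for i unfolding U_def using xC by (intro span_minimal C) auto
  have mono: "U i \<subseteq> U j" if "i \<le> j" for i j unfolding U_def using that by (intro span_mono) auto
  have sub: "subspace (U i)" for i by (simp add: U_def)
  have xU: "x i \<in> U j" if "i < j" for i j unfolding U_def using that by (intro span_base) auto
  have XU: "X u \<in> U (Suc i)" if "u \<in> U i" for u i
    using that unfolding U_def
  proof (rule span_closed[OF _ X(1)])
    fix y assume "y \<in> x ` {..<i}"
    then obtain j where "j < i" "y = x j" by auto
    then have "X y = x (Suc j)" "Suc j < Suc i" by (simp_all add: x_def)
    then show "X y \<in> span (x ` {..<Suc i})" by (auto intro: span_base)
  qed simp
  have tri: "\<rho> k (x i) - \<omega> k *s x i \<in> U i" if "k \<in> K" for k i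
    using that
  proof (induction i arbitrary: k)
    case 0
    then show ?case using w sub subspace_0 by (auto simp: x_def)
  next
    case (Suc i)
    let ?y = "x i"
    have "\<rho> k (x (Suc i)) - \<omega> k *s x (Suc i)
        = X (\<rho> k ?y - \<omega> k *s ?y) - ((\<rho> (\<delta> k) ?y - \<omega> (\<delta> k) *s ?y) + \<omega> (\<delta> k) *s ?y)"
      using \<delta>(2)[OF Suc.prems xC[of i]] X(1) by (simp add: x_def lin_simps)
    also have "\<dots> \<in> U (Suc i)"
    proof -
      have a: "X (\<rho> k ?y - \<omega> k *s ?y) \<in> U (Suc i)" using XU Suc by blast
      have b: "\<rho> (\<delta> k) ?y - \<omega> (\<delta> k) *s ?y \<in> U (Suc i)"
        using Suc.IH[OF \<delta>(1)[OF Suc.prems]] mono[of i "Suc i"] by auto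
      have c: "?y \<in> U (Suc i)" using xU by simp
      show ?thesis by (rule subspace_diff[OF sub a subspace_add[OF sub b subspace_scale[OF sub c]]])
    qed
    finally show ?case .
  qed
  have lower: "(\<lambda>v. \<rho> k v - \<omega> k *s v) ` U (Suc i) \<subseteq> U i" if k: "k \<in> K" for k i
  proof (rule image_subsetI)
    fix v assume "v \<in> U (Suc i)"
    then show "\<rho> k v - \<omega> k *s v \<in> U i"
      unfolding U_def
    proof (rule span_closed)
      fix y assume "y \<in> x ` {..<Suc i}"
      then obtain j where "y = x j" "j \<le> i" by auto
      then show "\<rho> k y - \<omega> k *s y \<in> span (x ` {..<i})"
        using tri[OF k, of j] mono[of j i] unfolding U_def by auto
    qed (use \<rho>(1)[OF k] lin_shift in auto)
  qed
  have \<rho>U: "\<rho> k ` U i \<subseteq> U i" if k: "k \<in> K" for k i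
  proof (rule image_subsetI)
    fix v assume v: "v \<in> U i"
    then have "\<rho> k v - \<omega> k *s v \<in> U i" using lower[OF k, of i] mono[of i "Suc i"] by auto
    then have "(\<rho> k v - \<omega> k *s v) + \<omega> k *s v \<in> U i"
      using v by (intro subspace_add subspace_scale sub)
    then show "\<rho> k v \<in> U i" by simp
  qed
  obtain n where n: "x n \<in> U n"
    using krylov_dependence[of X w] unfolding x_def U_def by metis
  have "n \<noteq> 0"
  proof
    assume "n = 0"
    then show False using n w(2) by (simp add: U_def x_def)
  qed
  then have wU: "w \<in> U n" using xU[of 0 n] by (simp add: x_def)
  have XUn: "X ` U n \<subseteq> U n"
  proof (rule image_subsetI)
    fix v assume "v \<in> U n"
    then show "X v \<in> U n"
      unfolding U_def
    proof (rule span_closed[OF _ X(1)])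
      fix y assume "y \<in> x ` {..<n}"
      then obtain j where j: "y = x j" "j < n" by auto
      show "X y \<in> span (x ` {..<n})"
      proof (cases "Suc j = n")
        case True
        then have "X y = x n" using j by (auto simp: x_def)
        then show ?thesis using n by (simp add: U_def)
      next
        case False
        then show ?thesis using xU[of "Suc j" n] j by (simp add: x_def U_def)
      qed
    qed simp
  qed
  note dk = \<delta>(1)[OF k]
  have l: "lin (\<lambda>v. X (\<rho> k v))" "lin (\<lambda>v. \<rho> k (X v))"
    using lin_comp X(1) \<rho>(1)[OF k] by blast+
  have "trace_on (U n) (\<rho> (\<delta> k)) = trace_on (U n) (\<lambda>v. X (\<rho> k v) - \<rho> k (X v))"
    by (rule trace_on_cong) (use sub \<rho> dk l lin_minus \<rho>U[OF dk] \<delta>(2)[OF k] UC[of n] in auto)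
  also have "\<dots> = trace_on (U n) (\<lambda>v. X (\<rho> k v)) - trace_on (U n) (\<lambda>v. \<rho> k (X v))"
    by (rule trace_on_diff[OF sub l]) (use \<rho>U[OF k, of n] XUn in auto)
  also have "\<dots> = 0"
    using trace_on_comm[OF sub X(1) \<rho>(1)[OF k] XUn \<rho>U[OF k]] by simp
  finally have t0: "trace_on (U n) (\<rho> (\<delta> k)) = 0" .
  have "trace_on (U n) (\<lambda>v. \<rho> (\<delta> k) v - \<omega> (\<delta> k) *s v) = 0"
    by (rule trace_on_flag[where W=U])
       (use sub mono lower[OF dk] lin_shift[OF \<rho>(1)[OF dk]] in \<open>auto simp: U_def\<close>)
  moreover have "trace_on (U n) (\<lambda>v. \<rho> (\<delta> k) v - \<omega> (\<delta> k) *s v)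
      = trace_on (U n) (\<rho> (\<delta> k)) - trace_on (U n) (\<lambda>v. \<omega> (\<delta> k) *s v)"
    by (rule trace_on_diff[OF sub \<rho>(1)[OF dk] lin_smult[OF lin_id] \<rho>U[OF dk]])
       (use subspace_scale[OF sub] in auto)
  moreover have "trace_on (U n) (\<lambda>v. \<omega> (\<delta> k) *s v) = \<omega> (\<delta> k) * of_nat (dim (U n))"
    using trace_on_scale[OF sub lin_id] trace_on_id[OF sub] by simp
  moreover have "dim (U n) \<noteq> 0" using wU w(2) by auto
  ultimately show ?thesis using t0 by simp
qed

lemma hyperplane_exists:
  assumes D: "subspace D" and B: "subspace B" and "D \<subseteq> B" "D \<noteq> B"
  obtains K x where "subspace K" "D \<subseteq> K" "K \<subseteq> B" "x \<in> B" "x \<notin> K"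
    "\<And>b. b \<in> B \<Longrightarrow> \<exists>c. b - c *s x \<in> K"
proof -
  obtain A where A: "independent A" "span A = D" "A \<subseteq> D" using subspace_basis D by metis
  obtain A' where A': "A \<subseteq> A'" "A' \<subseteq> B" "independent A'" "B \<subseteq> span A'"
    using maximal_independent_subset_extend[of A B] A assms(3) by blast
  have sp: "span A' = B" using A' B span_subspace by metis
  have "A \<noteq> A'" using A(2) sp assms(4) by auto
  then obtain x where x: "x \<in> A'" "x \<notin> A" using A'(1) by blast
  show thesis
  proof
    show "subspace (span (A' - {x}))" by simp
    show "D \<subseteq> span (A' - {x})" unfolding A(2)[symmetric] using x A' by (intro span_mono) auto
    show "span (A' - {x}) \<subseteq> B" unfolding sp[symmetric] by (intro span_mono) auto
    show "x \<in> B" using x A' by auto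
    show "x \<notin> span (A' - {x})" using x A'(3) by (auto simp: dependent_def)
    show "\<exists>c. b - c *s x \<in> span (A' - {x})" if "b \<in> B" for b
      using that span_breakdown[OF x(1)] sp by metis
  qed
qed

text \<open>The dual basis is the preimage of \<open>B\<close> under \<open>x \<mapsto> \<Sum> \<beta> x b b\<close>, which is injective on \<open>J\<close> by
  nondegeneracy. The expansions in both bases are the form in which duality is used later.\<close>
lemma dual_basis_exists:
  assumes J: "subspace J"
    and bilin: "\<And>x x' y. \<beta> (x + x') y = \<beta> x y + \<beta> x' y" "\<And>c x y. \<beta> (c *s x) y = c * \<beta> x y"
      "\<And>x y y'. \<beta> x (y + y') = \<beta> x y + \<beta> x y'" "\<And>c x y. \<beta> x (c *s y) = c * \<beta> x y"
    and nondeg: "\<And>x. x \<in> J \<Longrightarrow> (\<And>y. y \<in> J \<Longrightarrow> \<beta> x y = 0) \<Longrightarrow> x = 0"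
  obtains B d where "finite B" "independent B" "span B = J" "B \<subseteq> J" "\<And>b. b \<in> B \<Longrightarrow> d b \<in> J"
    "\<And>b. b \<in> B \<Longrightarrow> \<beta> (d b) b = 1"
    "\<And>x. x \<in> J \<Longrightarrow> x = (\<Sum>b\<in>B. \<beta> (d b) x *s b)"
    "\<And>x. x \<in> J \<Longrightarrow> x = (\<Sum>b\<in>B. \<beta> x b *s d b)"
proof -
  obtain B where B: "independent B" "span B = J" "finite B" "B \<subseteq> J" using subspace_basis J by metis
  have \<beta>0: "\<beta> x 0 = 0" "\<beta> 0 x = 0" for x using bilin(2)[of 0 0 x] bilin(4)[of x 0 0] by simp_all
  have \<beta>sum: "\<beta> x (\<Sum>i\<in>I. f i) = (\<Sum>i\<in>I. \<beta> x (f i))" "\<beta> (\<Sum>i\<in>I. f i) x = (\<Sum>i\<in>I. \<beta> (f i) x)"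
    for x I and f :: "'v \<Rightarrow> 'v"
    by (induction I rule: infinite_finite_induct) (simp_all add: \<beta>0 bilin)
  have zero: "x = 0" if "x \<in> J" "\<And>b. b \<in> B \<Longrightarrow> \<beta> x b = 0" for x
  proof (rule nondeg[OF that(1)])
    fix y assume "y \<in> J"
    moreover have "span B \<subseteq> {y. \<beta> x y = 0}"
      using that(2) by (intro span_minimal) (auto simp: subspace_def \<beta>0 bilin)
    ultimately show "\<beta> x y = 0" using B(2) by auto
  qed
  define T where "T x = (\<Sum>b\<in>B. \<beta> x b *s b)" for x
  have T: "lin T"
    unfolding T_def
    by (rule linI) (simp_all add: bilin scale_left_distrib sum.distrib scale_sum_right)
  have uniq: "f b = g b" if "(\<Sum>b\<in>B. f b *s b) = (\<Sum>b\<in>B. g b *s b)" "b \<in> B" for f g b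
  proof -
    have "(\<Sum>b\<in>B. (f b - g b) *s b) = 0" using that by (simp add: scale_left_diff_distrib sum_subtractf)
    then have "f b - g b = 0" using independentD[OF B(1) B(3) order_refl, of "\<lambda>b. f b - g b" b] that(2) by simp
    then show ?thesis by simp
  qed
  have "T ` J = J"
  proof (rule injective_endomorphism_onto[OF T J])
    show "T ` J \<subseteq> J" unfolding T_def using B J by (auto intro!: subspace_sum subspace_scale)
    show "x = 0" if "x \<in> J" "T x = 0" for x
      using zero[OF that(1)] uniq[of "\<beta> x" "\<lambda>_. 0"] that(2) by (simp add: T_def)
  qed
  then have "\<forall>b\<in>B. \<exists>x\<in>J. T x = b" using B(4) by (metis imageE subsetD)
  then obtain d where d: "\<And>b. b \<in> B \<Longrightarrow> d b \<in> J" "\<And>b. b \<in> B \<Longrightarrow> T (d b) = b" by metis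
  have \<delta>: "\<beta> (d b) c = (if c = b then 1 else 0)" if "b \<in> B" "c \<in> B" for b c
  proof (rule uniq[of "\<beta> (d b)" "\<lambda>c. if c = b then 1 else 0", OF _ that(2)])
    have "(\<Sum>c\<in>B. (if c = b then 1 else 0) *s c) = (\<Sum>c\<in>B. if c = b then b else 0)"
      by (rule sum.cong) auto
    also have "\<dots> = b" using that B(3) by simp
    finally show "(\<Sum>c\<in>B. \<beta> (d b) c *s c) = (\<Sum>c\<in>B. (if c = b then 1 else 0) *s c)"
      using d(2)[OF that(1)] by (simp add: T_def)
  qed
  show thesis
  proof (rule that[OF B(3,1,2,4) d(1)])
    show "\<beta> (d b) b = 1" if "b \<in> B" for b using \<delta>[OF that that] by simp
    fix x assume x: "x \<in> J"
    have "x = (\<Sum>b\<in>B. representation B x b *s b)"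
      using sum_representation_eq[OF B(1) _ B(3)] x B(2) by simp
    moreover have "\<beta> (d b) x = representation B x b" if "b \<in> B" for b
    proof -
      have "\<beta> (d b) x = \<beta> (d b) (\<Sum>c\<in>B. representation B x c *s c)" using calculation by simp
      also have "\<dots> = (\<Sum>c\<in>B. representation B x c * (if c = b then 1 else 0))"
        using \<delta>[OF that] by (simp add: \<beta>sum bilin)
      also have "\<dots> = representation B x b" using that B(3) by (simp add: if_distrib cong: if_cong)
      finally show ?thesis .
    qed
    ultimately show "x = (\<Sum>b\<in>B. \<beta> (d b) x *s b)" by simp
    have "x - (\<Sum>b\<in>B. \<beta> x b *s d b) = 0"
    proof (rule zero)
      show "x - (\<Sum>b\<in>B. \<beta> x b *s d b) \<in> J"
        using x d J by (auto intro!: subspace_diff subspace_sum subspace_scale)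
      fix c assume c: "c \<in> B"
      have "\<beta> (\<Sum>b\<in>B. \<beta> x b *s d b) c = (\<Sum>b\<in>B. \<beta> x b * (if b = c then 1 else 0))"
        using \<delta>[OF _ c] by (simp add: \<beta>sum bilin eq_commute[of c])
      also have "\<dots> = \<beta> x c" using c B(3) by (simp add: if_distrib cong: if_cong)
      finally have "\<beta> (\<Sum>b\<in>B. \<beta> x b *s d b) c = \<beta> x c" .
      moreover have "\<beta> x c = \<beta> (x - (\<Sum>b\<in>B. \<beta> x b *s d b)) c + \<beta> (\<Sum>b\<in>B. \<beta> x b *s d b) c"
        by (simp add: bilin(1)[symmetric])
      ultimately show "\<beta> (x - (\<Sum>b\<in>B. \<beta> x b *s d b)) c = 0" by simp
    qed
    then show "x = (\<Sum>b\<in>B. \<beta> x b *s d b)" by simp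
  qed
qed

lemma bilinear_product_lin:
  assumes "bilinear_product scale \<rho>"
  shows "lin (\<lambda>x. \<rho> x y)" "lin (\<rho> x)"
  using assms by (auto simp: bilinear_product_def)

end

section \<open>Solvable Lie algebras\<close>

locale fin_lie_algebra = complex_space scale basis + lie_algebra scale bracket
  for scale :: "complex \<Rightarrow> 'v::ab_group_add \<Rightarrow> 'v" (infixr \<open>*s\<close> 75)
    and basis :: "'v set" and bracket :: "'v \<Rightarrow> 'v \<Rightarrow> 'v" (\<open>\<lbrakk>_, _\<rbrakk>\<close>)
begin

lemmas bracket_lin = bilinear_product_lin[OF bilinear]

lemmas bracket_simps = lin_simps[OF bracket_lin(1)] lin_simps[OF bracket_lin(2)]

lemma bracket_anti: "\<lbrakk>x, y\<rbrakk> = - \<lbrakk>y, x\<rbrakk>"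
proof -
  have "\<lbrakk>x, y\<rbrakk> + \<lbrakk>y, x\<rbrakk> = \<lbrakk>x + y, x + y\<rbrakk>"
    by (simp only: bracket_simps) (simp add: alternating add.commute)
  then show ?thesis by (simp add: alternating eq_neg_iff_add_eq_0)
qed

lemma bracket_derivation: "\<lbrakk>x, \<lbrakk>y, z\<rbrakk>\<rbrakk> = \<lbrakk>\<lbrakk>x, y\<rbrakk>, z\<rbrakk> + \<lbrakk>y, \<lbrakk>x, z\<rbrakk>\<rbrakk>"
proof -
  have "\<lbrakk>y, \<lbrakk>z, x\<rbrakk>\<rbrakk> = - \<lbrakk>y, \<lbrakk>x, z\<rbrakk>\<rbrakk>" using bracket_anti[of z x] by (simp add: bracket_simps)
  moreover have "\<lbrakk>z, \<lbrakk>x, y\<rbrakk>\<rbrakk> = - \<lbrakk>\<lbrakk>x, y\<rbrakk>, z\<rbrakk>" by (rule bracket_anti)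
  ultimately have "\<lbrakk>x, \<lbrakk>y, z\<rbrakk>\<rbrakk> + - \<lbrakk>y, \<lbrakk>x, z\<rbrakk>\<rbrakk> + - \<lbrakk>\<lbrakk>x, y\<rbrakk>, z\<rbrakk> = 0"
    using jacobi[of x y z] by (simp only:)
  then show ?thesis by (simp add: algebra_simps)
qed

lemma bracket_space_mono: "A \<subseteq> A' \<Longrightarrow> B \<subseteq> B' \<Longrightarrow> bracket_space A B \<subseteq> bracket_space A' B'"
  unfolding bracket_space_def by (intro span_mono) blast

lemma subspace_bracket_space: "subspace (bracket_space A B)"
  by (simp add: bracket_space_def)

lemma bracket_in_bracket_space: "a \<in> A \<Longrightarrow> b \<in> B \<Longrightarrow> \<lbrakk>a, b\<rbrakk> \<in> bracket_space A B"
  unfolding bracket_space_def by (intro span_base) blast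

lemma bracket_space_least:
  "subspace W \<Longrightarrow> (\<And>a b. a \<in> A \<Longrightarrow> b \<in> B \<Longrightarrow> \<lbrakk>a, b\<rbrakk> \<in> W) \<Longrightarrow> bracket_space A B \<subseteq> W"
  unfolding bracket_space_def by (intro span_minimal) auto

definition subalgebra :: "'v set \<Rightarrow> bool"
  where "subalgebra B \<longleftrightarrow> subspace B \<and> (\<forall>x\<in>B. \<forall>y\<in>B. \<lbrakk>x, y\<rbrakk> \<in> B)"

primrec derived_of :: "'v set \<Rightarrow> nat \<Rightarrow> 'v set"
  where
    "derived_of B 0 = B"
  | "derived_of B (Suc k) = bracket_space (derived_of B k) (derived_of B k)"

definition solvable_set :: "'v set \<Rightarrow> bool"
  where "solvable_set B \<longleftrightarrow> (\<exists>k. derived_of B k \<subseteq> {0})"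

lemma derived_of_mono: "A \<subseteq> B \<Longrightarrow> derived_of A k \<subseteq> derived_of B k"
  by (induction k) (auto intro: bracket_space_mono[THEN subsetD])

lemma derived_of_UNIV: "derived_of UNIV k = derived_series k"
  by (induction k) auto

lemma derived_of_shift: "derived_of B (Suc k) = derived_of (bracket_space B B) k"
  by (induction k) auto

lemma solvable_set_mono: "A \<subseteq> B \<Longrightarrow> solvable_set B \<Longrightarrow> solvable_set A"
  unfolding solvable_set_def using derived_of_mono by blast

lemma perfect_solvable_trivial:
  assumes "B \<subseteq> bracket_space B B" "solvable_set B"
  shows "B \<subseteq> {0}"
proof -
  have "B \<subseteq> derived_of B k" for k
  proof (induction k)
    case (Suc k)
    then show ?case using assms(1) bracket_space_mono[OF Suc Suc] by auto
  qed simp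
  then show ?thesis using assms(2) unfolding solvable_set_def by blast
qed

text \<open>Lie's theorem, by induction on the dimension of \<open>B\<close>. Since \<open>B\<close> is not perfect, it has a subspace
  \<open>K\<close> of codimension one that contains all its brackets. The weight space of \<open>K\<close> given by the
  induction hypothesis is preserved by \<open>\<rho> x\<close> for \<open>x\<close> outside \<open>K\<close>, because the weight vanishes on
  brackets; an eigenvector of \<open>\<rho> x\<close> in this space serves for \<open>B\<close>.\<close>
theorem common_eigenvector:
  assumes "subalgebra B" "solvable_set B" and C: "subspace C" "C \<noteq> {0}"
    and bil: "bilinear_product scale \<rho>"
    and "\<And>b. b \<in> B \<Longrightarrow> \<rho> b ` C \<subseteq> C"
    and "\<And>a b v. a \<in> B \<Longrightarrow> b \<in> B \<Longrightarrow> v \<in> C \<Longrightarrow> \<rho> \<lbrakk>a, b\<rbrakk> v = \<rho> a (\<rho> b v) - \<rho> b (\<rho> a v)"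
  obtains v \<omega> where "v \<in> C" "v \<noteq> 0" "\<And>b. b \<in> B \<Longrightarrow> \<rho> b v = \<omega> b *s v"
proof -
  note lin1 = bilinear_product_lin(1)[OF bil] and lin2 = bilinear_product_lin(2)[OF bil]
  have "\<exists>v \<omega>. v \<in> C \<and> v \<noteq> 0 \<and> (\<forall>b\<in>B. \<rho> b v = \<omega> b *s v)"
    using assms(1,2,6,7)
  proof (induction "dim B" arbitrary: B rule: less_induct)
    case less
    note inv = less.prems(3) and hom = less.prems(4)
    have B: "subspace B" "\<And>x y. x \<in> B \<Longrightarrow> y \<in> B \<Longrightarrow> \<lbrakk>x, y\<rbrakk> \<in> B"
      using less.prems(1) by (auto simp: subalgebra_def)
    show ?case
    proof (cases "B \<subseteq> {0}")
      case True
      obtain v where "v \<in> C" "v \<noteq> 0" using C subspace_0 by blast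
      moreover have "\<rho> b v = 0 *s v" if "b \<in> B" for b
        using that True lin_0[OF lin1] by auto
      ultimately show ?thesis by (intro exI[of _ v] exI[of _ "\<lambda>_. 0"]) auto
    next
      case False
      let ?D = "bracket_space B B"
      have DB: "?D \<subseteq> B" using B by (intro bracket_space_least) auto
      have "?D \<noteq> B" using perfect_solvable_trivial[OF _ less.prems(2)] False by auto
      then obtain K x where K: "subspace K" "?D \<subseteq> K" "K \<subseteq> B" "x \<in> B" "x \<notin> K"
        "\<And>b. b \<in> B \<Longrightarrow> \<exists>c. b - c *s x \<in> K"
        using hyperplane_exists[OF subspace_bracket_space B(1) DB] by metis
      have brK: "\<lbrakk>a, b\<rbrakk> \<in> K" if "a \<in> B" "b \<in> B" for a b
        using bracket_in_bracket_space[OF that] K(2) by auto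
      have "span K = K" "span B = B" using K B by simp_all
      moreover have "K \<subset> B" using K(3-5) by blast
      ultimately have "dim K < dim B" using dim_psubset[of K B] by metis
      moreover have "subalgebra K" using K(1,3) brK unfolding subalgebra_def by blast
      moreover have "solvable_set K" using solvable_set_mono[OF K(3)] less.prems(2) by blast
      ultimately have "\<exists>v \<omega>. v \<in> C \<and> v \<noteq> 0 \<and> (\<forall>b\<in>K. \<rho> b v = \<omega> b *s v)"
      proof (rule less.hyps)
        show "\<rho> b ` C \<subseteq> C" if "b \<in> K" for b using inv that K(3) by blast
        show "\<rho> \<lbrakk>a, b\<rbrakk> v = \<rho> a (\<rho> b v) - \<rho> b (\<rho> a v)" if "a \<in> K" "b \<in> K" "v \<in> C" for a b v
          using hom that K(3) by blast
      qed
      then obtain v \<omega> where v: "v \<in> C" "v \<noteq> 0" "\<And>k. k \<in> K \<Longrightarrow> \<rho> k v = \<omega> k *s v" by blast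
      define W where "W = {w \<in> C. \<forall>k\<in>K. \<rho> k w = \<omega> k *s w}"
      have W: "subspace W"
        unfolding W_def using C(1)
        by (auto simp: subspace_def lin_simps[OF lin2] scale_right_distrib scale_left_commute)
      have "\<rho> x ` W \<subseteq> W"
      proof (rule image_subsetI)
        fix w assume "w \<in> W"
        then have w: "w \<in> C" "\<And>k. k \<in> K \<Longrightarrow> \<rho> k w = \<omega> k *s w" by (auto simp: W_def)
        have "\<rho> k (\<rho> x w) = \<omega> k *s \<rho> x w" if k: "k \<in> K" for k
        proof (cases "w = 0")
          case True
          then show ?thesis by (simp add: lin_0[OF lin2])
        next
          case False
          have "\<omega> \<lbrakk>x, k\<rbrakk> = 0"
            by (rule weight_vanishes_on_commutators[where C=C and X="\<rho> x" and \<rho>=\<rho> and \<delta>="bracket x"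
                  and K=K and w=w])
               (use C lin2 inv K brK hom False w k in auto)
          then have "\<rho> \<lbrakk>x, k\<rbrakk> w = 0" using w(2)[of "\<lbrakk>x, k\<rbrakk>"] brK K k by auto
          then have "\<rho> k (\<rho> x w) = \<rho> x (\<rho> k w)" using hom[of x k w] K k w by auto
          then show ?thesis using w(2)[OF k] by (simp add: lin_simps[OF lin2])
        qed
        then show "\<rho> x w \<in> W" using inv[OF K(4)] w(1) by (auto simp: W_def)
      qed
      moreover have "W \<noteq> {0}" using v by (auto simp: W_def)
      ultimately obtain \<mu> u where u: "u \<in> W" "u \<noteq> 0" "\<rho> x u = \<mu> *s u"
        using eigenvector_exists[OF W _ lin2] by metis
      have "\<exists>s. \<rho> b u = s *s u" if b: "b \<in> B" for b
      proof -
        obtain c where c: "b - c *s x \<in> K" using K(6)[OF b] by blast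
        have "\<rho> b u = \<rho> (b - c *s x) u + c *s \<rho> x u"
          by (simp add: lin_simps[OF lin1])
        also have "\<dots> = (\<omega> (b - c *s x) + c * \<mu>) *s u"
          using u c by (simp add: W_def scale_left_distrib)
        finally show ?thesis by blast
      qed
      then obtain s where "\<forall>b\<in>B. \<rho> b u = s b *s u" by metis
      then show ?thesis using u by (auto simp: W_def)
    qed
  qed
  then show thesis using that by blast
qed

definition derivation :: "('v \<Rightarrow> 'v) \<Rightarrow> bool"
  where "derivation D \<longleftrightarrow> lin D \<and> (\<forall>x y. D \<lbrakk>x, y\<rbrakk> = \<lbrakk>D x, y\<rbrakk> + \<lbrakk>x, D y\<rbrakk>)"

lemma derivation_bracket: "derivation (bracket u)"
  unfolding derivation_def using bracket_lin(2) bracket_derivation by blast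

text \<open>By Lie's theorem the adjoint action on the quotient by \<open>M\<close> has a weight \<open>\<omega>\<close>, and \<open>M'\<close> is the
  preimage of its weight space. The weight vanishes on the image of every derivation in \<open>\<D>\<close>. This is
  why \<open>M'\<close> is invariant again and why the elements \<open>D y\<close> map it into \<open>M\<close>.\<close>
lemma solvable_flag_step:
  assumes sol: "solvable" and der: "\<And>D. D \<in> \<D> \<Longrightarrow> derivation D"
    and inner: "\<And>u. bracket u \<in> \<D>"
    and M: "subspace M" "M \<noteq> UNIV" "\<And>D. D \<in> \<D> \<Longrightarrow> D ` M \<subseteq> M"
  obtains M' where "subspace M'" "M \<subset> M'" "\<And>D. D \<in> \<D> \<Longrightarrow> D ` M' \<subseteq> M'"
    "\<And>D y v. D \<in> \<D> \<Longrightarrow> v \<in> M' \<Longrightarrow> \<lbrakk>D y, v\<rbrakk> \<in> M"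
proof -
  obtain P where P: "lin P" "\<And>v. P v = 0 \<longleftrightarrow> v \<in> M" "\<And>v. v - P v \<in> M" "\<And>v. P (P v) = P v"
    using quotient_projection M(1) by metis
  have linD: "lin D" if "D \<in> \<D>" for D using der that by (auto simp: derivation_def)
  have PD: "P (D (P z)) = P (D z)" if "D \<in> \<D>" for D z
  proof -
    have "D (z - P z) \<in> M" using M(3)[OF that] P(3) by auto
    then have "P (D (z - P z)) = 0" using P(2) by blast
    then show ?thesis by (simp add: lin_simps[OF P(1)] lin_simps[OF linD[OF that]])
  qed
  define \<rho> where "\<rho> y v = P \<lbrakk>y, v\<rbrakk>" for y v
  have bil: "bilinear_product scale \<rho>"
    unfolding bilinear_product_def \<rho>_def using lin_comp[OF P(1)] bracket_lin by blast
  obtain z where "z \<notin> M" using M(2) by blast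
  then have "P z \<noteq> 0" using P(2) by blast
  then have C: "subspace (range P)" "range P \<noteq> {0}"
    using module_hom.subspace_image[OF lin_hom[OF P(1)] subspace_UNIV] by blast+
  have hom: "\<rho> \<lbrakk>a, b\<rbrakk> v = \<rho> a (\<rho> b v) - \<rho> b (\<rho> a v)" for a b v
    unfolding \<rho>_def PD[OF inner] bracket_derivation[of a b v]
    by (simp add: lin_simps[OF P(1)])
  have "subalgebra UNIV" by (simp add: subalgebra_def)
  moreover have "solvable_set UNIV"
    using sol by (auto simp: solvable_set_def solvable_def derived_of_UNIV)
  ultimately obtain v \<omega> where v: "v \<in> range P" "v \<noteq> 0" "\<And>y. \<rho> y v = \<omega> y *s v"
    by (rule common_eigenvector[OF _ _ C bil]) (use hom in \<open>auto simp: \<rho>_def\<close>)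
  have \<omega>0: "\<omega> (D y) = 0" if D: "D \<in> \<D>" for D y
  proof (rule weight_vanishes_on_commutators[where C="range P" and X="\<lambda>x. P (D x)" and \<rho>=\<rho> and \<delta>=D
        and K=UNIV and w=v])
    show "lin (\<lambda>x. P (D x))" using lin_comp P(1) linD[OF D] by blast
    show "\<rho> (D k) w = P (D (\<rho> k w)) - \<rho> k (P (D w))" for k w
    proof -
      have "D \<lbrakk>k, w\<rbrakk> = \<lbrakk>D k, w\<rbrakk> + \<lbrakk>k, D w\<rbrakk>" using der[OF D] by (auto simp: derivation_def)
      then show ?thesis unfolding \<rho>_def PD[OF D] PD[OF inner] by (simp add: lin_simps[OF P(1)])
    qed
  qed (use C v bilinear_product_lin(2)[OF bil] in \<open>auto simp: \<rho>_def\<close>)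
  define M' where "M' = {w. \<forall>y. P \<lbrakk>y, w\<rbrakk> = \<omega> y *s P w}"
  show thesis
  proof
    show "subspace M'"
      unfolding M'_def
      by (auto simp: subspace_def bracket_simps lin_simps[OF P(1)] scale_right_distrib scale_left_commute)
    have "m \<in> M'" if "m \<in> M" for m
    proof -
      have "P \<lbrakk>y, m\<rbrakk> = 0" for y using M(3)[OF inner] that P(2) by blast
      moreover have "P m = 0" using that P(2) by blast
      ultimately show ?thesis by (simp add: M'_def)
    qed
    moreover have Pv: "P v = v" using v(1) P(4) by auto
    then have "v \<in> M'" "v \<notin> M" using v(2,3) P(2)[of v] by (auto simp: M'_def \<rho>_def)
    ultimately show "M \<subset> M'" by blast
    show "\<lbrakk>D y, w\<rbrakk> \<in> M" if "D \<in> \<D>" "w \<in> M'" for D y w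
    proof -
      have "P \<lbrakk>D y, w\<rbrakk> = 0" using that \<omega>0[OF that(1)] by (simp add: M'_def)
      then show ?thesis using P(2) by blast
    qed
    show "D ` M' \<subseteq> M'" if D: "D \<in> \<D>" for D
    proof (rule image_subsetI)
      fix w assume w: "w \<in> M'"
      have "P \<lbrakk>y, D w\<rbrakk> = \<omega> y *s P (D w)" for y
      proof -
        have "P \<lbrakk>D y, w\<rbrakk> = 0" using w \<omega>0[OF D] by (auto simp: M'_def)
        moreover have "D \<lbrakk>y, w\<rbrakk> = \<lbrakk>D y, w\<rbrakk> + \<lbrakk>y, D w\<rbrakk>" using der[OF D] by (auto simp: derivation_def)
        ultimately have "P \<lbrakk>y, D w\<rbrakk> = P (D \<lbrakk>y, w\<rbrakk>)" by (simp add: lin_simps[OF P(1)])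
        also have "\<dots> = P (D (P \<lbrakk>y, w\<rbrakk>))" using PD[OF D] by simp
        also have "\<dots> = P (D (\<omega> y *s P w))" using w by (auto simp: M'_def)
        also have "\<dots> = \<omega> y *s P (D w)"
          using PD[OF D] by (simp add: lin_simps[OF P(1)] lin_simps[OF linD[OF D]])
        finally show ?thesis .
      qed
      then show "D w \<in> M'" by (simp add: M'_def)
    qed
  qed
qed

text \<open>Every derivation of a solvable Lie algebra has its image in the nilradical. The flag expresses
  this simultaneously for a family of derivations that contains the inner ones, and it records that
  the family itself is triangular as well.\<close>
theorem solvable_flag:
  assumes sol: "solvable" and der: "\<And>D. D \<in> \<D> \<Longrightarrow> derivation D"
    and inner: "\<And>u. bracket u \<in> \<D>"
  obtains W n where "W 0 = {0}" "W n = UNIV" "\<And>i. subspace (W i)" "\<And>i. W i \<subseteq> W (Suc i)"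
    "\<And>i D. D \<in> \<D> \<Longrightarrow> D ` W i \<subseteq> W i"
    "\<And>i D y v. D \<in> \<D> \<Longrightarrow> v \<in> W (Suc i) \<Longrightarrow> \<lbrakk>D y, v\<rbrakk> \<in> W i"
proof -
  define good where "good M \<longleftrightarrow> subspace M \<and> (\<forall>D\<in>\<D>. D ` M \<subseteq> M)" for M
  define up where "up M M' \<longleftrightarrow> good M' \<and> M \<subseteq> M' \<and> (M \<noteq> UNIV \<longrightarrow> M \<noteq> M') \<and>
    (\<forall>D\<in>\<D>. \<forall>y. \<forall>v\<in>M'. \<lbrakk>D y, v\<rbrakk> \<in> M)" for M M'
  have ex: "\<exists>M'. up M M'" if "good M" for M
  proof (cases "M = UNIV")
    case True
    then show ?thesis using that by (intro exI[of _ UNIV]) (auto simp: up_def)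
  next
    case False
    have M: "subspace M" "\<And>D. D \<in> \<D> \<Longrightarrow> D ` M \<subseteq> M" using that by (auto simp: good_def)
    obtain M' where "subspace M'" "M \<subset> M'" "\<And>D. D \<in> \<D> \<Longrightarrow> D ` M' \<subseteq> M'"
      "\<And>D y v. D \<in> \<D> \<Longrightarrow> v \<in> M' \<Longrightarrow> \<lbrakk>D y, v\<rbrakk> \<in> M"
      using solvable_flag_step[OF sol der inner M(1) False M(2)] by metis
    then show ?thesis unfolding up_def good_def by blast
  qed
  define W where "W i = ((\<lambda>M. SOME M'. up M M') ^^ i) {0}" for i
  have good0: "good {0}"
    using der lin_0 by (auto simp: good_def derivation_def)
  have step: "good (W i) \<and> up (W i) (W (Suc i))" for i
  proof (induction i)
    case 0
    then show ?case using good0 someI_ex[OF ex[OF good0]] by (simp add: W_def)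
  next
    case (Suc i)
    then have g: "good (W (Suc i))" by (simp add: up_def)
    show ?case using g someI_ex[OF ex[OF g]] by (simp add: W_def)
  qed
  have grow: "W i = UNIV \<or> i \<le> dim (W i)" for i
  proof (induction i)
    case (Suc i)
    have u: "up (W i) (W (Suc i))" and g: "good (W i)" "good (W (Suc i))" using step by auto
    show ?case
    proof (cases "W i = UNIV")
      case True
      then show ?thesis using u by (auto simp: up_def)
    next
      case False
      then have "W i \<subset> W (Suc i)" using u by (auto simp: up_def)
      moreover have "span (W i) = W i" "span (W (Suc i)) = W (Suc i)" using g by (simp_all add: good_def)
      ultimately have "dim (W i) < dim (W (Suc i))" using dim_psubset by metis
      then show ?thesis using Suc False by simp
    qed
  qed simp
  have top: "W (Suc dimension) = UNIV"
    using grow[of "Suc dimension"] dim_subset_UNIV[of "W (Suc dimension)"] by auto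
  show thesis
  proof
    show "W 0 = {0}" by (simp add: W_def)
    show "W (Suc dimension) = UNIV" by (rule top)
  qed (use step in \<open>auto simp: good_def up_def\<close>)
qed

section \<open>Trace forms and nilpotent actions\<close>


definition action :: "('v \<Rightarrow> 'v \<Rightarrow> 'v) \<Rightarrow> bool"
  where "action \<rho> \<longleftrightarrow> bilinear_product scale \<rho> \<and>
    (\<forall>x y v. \<rho> \<lbrakk>x, y\<rbrakk> v = \<rho> x (\<rho> y v) - \<rho> y (\<rho> x v))"

lemma action_lin:
  assumes "action \<rho>"
  shows "lin (\<lambda>x. \<rho> x v)" "lin (\<rho> x)"
  using assms bilinear_product_lin by (auto simp: action_def)

lemma action_bracket: "action \<rho> \<Longrightarrow> \<rho> \<lbrakk>x, y\<rbrakk> v = \<rho> x (\<rho> y v) - \<rho> y (\<rho> x v)"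
  by (simp add: action_def)

text \<open>By the Leibniz rule \<open>\<rho> x - (a + c)\<close> turns \<open>\<rho> y v\<close> into the sum of two such products, one with
  \<open>(ad x - c) y\<close> in place of \<open>y\<close> and one with \<open>(\<rho> x - a) v\<close> in place of \<open>v\<close>. Each application thus
  lowers one of the two nilpotency exponents, until one factor is zero.\<close>
lemma gen_eigenspace_action:
  assumes act: "action \<rho>" and y: "y \<in> gen_eigenspace (bracket x) c"
    and v: "v \<in> gen_eigenspace (\<rho> x) a"
  shows "\<rho> y v \<in> gen_eigenspace (\<rho> x) (a + c)"
proof -
  note l1 = lin_simps[OF action_lin(1)[OF act]] and l2 = lin_simps[OF action_lin(2)[OF act]]
  let ?A = "\<lambda>y. \<lbrakk>x, y\<rbrakk> - c *s y" and ?R = "\<lambda>v. \<rho> x v - a *s v"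
    and ?Q = "\<lambda>v. \<rho> x v - (a + c) *s v"
  have Q: "lin (?Q ^^ k)" for k by (intro lin_funpow lin_shift action_lin(2) act)
  have "(?Q ^^ (m + n)) (\<rho> y v) = 0" if "(?A ^^ m) y = 0" "(?R ^^ n) v = 0" for m n
    using that
  proof (induction "m + n" arbitrary: m n y v)
    case 0
    then show ?case by (simp add: l1)
  next
    case (Suc k)
    consider "m = 0" | "n = 0" | m' n' where "m = Suc m'" "n = Suc n'"
      by (meson not0_implies_Suc)
    then show ?case
    proof cases
      case 1
      then have "\<rho> y v = 0" using Suc.prems by (simp add: l1)
      then show ?thesis using lin_0[OF Q] by simp
    next
      case 2
      then have "\<rho> y v = 0" using Suc.prems by (simp add: l2)
      then show ?thesis using lin_0[OF Q] by simp
    next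
      case 3
      have "?Q (\<rho> y v) = \<rho> (?A y) v + \<rho> y (?R v)"
        by (simp add: action_bracket[OF act] l1 l2 scale_left_distrib)
      then have step: "(?Q ^^ Suc k) (\<rho> y v) = (?Q ^^ k) (\<rho> (?A y) v) + (?Q ^^ k) (\<rho> y (?R v))"
        by (simp only: funpow_Suc_right comp_apply lin_add[OF Q])
      have k: "k = m' + n" "k = m + n'" using Suc.hyps(2) 3 by auto
      have "(?Q ^^ (m' + n)) (\<rho> (?A y) v) = 0"
        by (rule Suc.hyps(1)) (use Suc 3 in \<open>simp_all add: funpow_Suc_right del: funpow.simps\<close>)
      moreover have "(?Q ^^ (m + n')) (\<rho> y (?R v)) = 0"
        by (rule Suc.hyps(1)) (use Suc 3 in \<open>simp_all add: funpow_Suc_right del: funpow.simps\<close>)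
      ultimately have "(?Q ^^ Suc k) (\<rho> y v) = 0"
        unfolding step by (simp only: k[symmetric] add_0_left)
      then show ?thesis by (simp only: Suc.hyps(2))
    qed
  qed
  then show ?thesis using y v by (auto simp: gen_eigenspace_def)
qed

text \<open>Cartan's criterion. Let \<open>Y\<close> act on the generalized eigenspaces of \<open>\<rho> x\<close> by the conjugate eigenvalues
  and let \<open>D\<close> do the same for \<open>ad x\<close>. As conjugation is additive, \<open>[Y, \<rho> y] = \<rho> (D y)\<close>.
  Therefore \<open>trace (Y \<rho> [z, y]) = trace (\<rho> (D z) \<rho> y) = 0\<close> for \<open>y\<close> in \<open>S\<close>, and \<open>trace (Y \<rho> x) = 0\<close>
  follows by linearity. Hence all eigenvalues of \<open>\<rho> x\<close> are zero.\<close>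
theorem cartan_nilpotent:
  assumes act: "action \<rho>"
    and zero: "\<And>z y. y \<in> S \<Longrightarrow> trace_on UNIV (\<lambda>v. \<rho> z (\<rho> y v)) = 0"
    and x: "x \<in> bracket_space UNIV S"
  shows "gen_eigenspace (\<rho> x) 0 = UNIV"
proof (rule nilpotent_if_conjugate_trace_zero)
  note L1 = action_lin(1)[OF act] and L2 = action_lin(2)[OF act]
  show "lin (\<rho> x)" by (rule L2)
  fix Y assume Y: "lin Y" "\<And>a v. v \<in> gen_eigenspace (\<rho> x) a \<Longrightarrow> Y v = cnj a *s v"
  obtain D where D: "lin D" "\<And>c y. y \<in> gen_eigenspace (bracket x) c \<Longrightarrow> D y = cnj c *s y"
    using spectral_function[OF bracket_lin(2)] by metis
  define E where "E y v = Y (\<rho> y v) - \<rho> y (Y v) - \<rho> (D y) v" for y v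
  have E1: "lin (\<lambda>y. E y v)" for v
    unfolding E_def by (intro lin_minus lin_comp[OF Y(1)] lin_comp[OF L1 D(1)] L1)
  have E2: "lin (E y)" for y
    unfolding E_def by (intro lin_minus lin_comp[OF Y(1)] lin_comp[OF L2 Y(1)] L2)
  have gen: "E y v = 0" if y: "y \<in> gen_eigenspace (bracket x) c" and v: "v \<in> gen_eigenspace (\<rho> x) a"
    for y v a c
    unfolding E_def Y(2)[OF gen_eigenspace_action[OF act y v]] Y(2)[OF v] D(2)[OF y]
    by (simp add: lin_scale[OF L1] lin_scale[OF L2] scale_left_distrib)
  have gen': "E y v = 0" if y: "y \<in> gen_eigenspace (bracket x) c" for y v c
  proof -
    have "v \<in> span (\<Union>a. gen_eigenspace (\<rho> x) a)" using gen_eigenspaces_span[OF L2] by simp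
    then have "E y v \<in> {0}" by (rule span_closed[OF _ E2]) (use gen[OF y] in auto)
    then show ?thesis by simp
  qed
  have commutes: "E y v = 0" for y v
  proof -
    have "y \<in> span (\<Union>a. gen_eigenspace (bracket x) a)"
      using gen_eigenspaces_span[OF bracket_lin(2)] by simp
    then have "E y v \<in> {0}" by (rule span_closed[OF _ E1]) (use gen' in auto)
    then show ?thesis by simp
  qed
  have YL: "lin (\<lambda>v. Y (\<rho> z v))" for z by (intro lin_comp[OF Y(1)] L2)
  let ?K = "{z. trace_on UNIV (\<lambda>v. Y (\<rho> z v)) = 0}"
  have "subspace ?K"
  proof (rule subspaceI)
    show "0 \<in> ?K" by (simp add: lin_0[OF L1] lin_0[OF Y(1)] trace_on_zero)
    show "a + b \<in> ?K" if "a \<in> ?K" "b \<in> ?K" for a b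
      using that trace_on_add[OF subspace_UNIV YL[of a] YL[of b]]
      by (simp add: lin_add[OF L1] lin_add[OF Y(1)])
    show "c *s a \<in> ?K" if "a \<in> ?K" for a c
      using that trace_on_scale[OF subspace_UNIV YL[of a], of c]
      by (simp add: lin_scale[OF L1] lin_scale[OF Y(1)])
  qed
  moreover have "\<lbrakk>z, y\<rbrakk> \<in> ?K" if y: "y \<in> S" for z y
  proof -
    have l: "lin (\<lambda>v. Y (\<rho> z (\<rho> y v)))" "lin (\<lambda>v. Y (\<rho> y (\<rho> z v)))"
      "lin (\<lambda>v. \<rho> z (Y (\<rho> y v)))" "lin (\<lambda>v. \<rho> z (Y v))" "lin (\<lambda>v. Y (\<rho> z v))"
      using lin_comp[OF Y(1)] lin_comp[OF L2] L2 Y(1) by blast+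
    have D0: "Y (\<rho> z w) - \<rho> z (Y w) = \<rho> (D z) w" for w
      using commutes[of z w] by (simp add: E_def)
    have "trace_on UNIV (\<lambda>v. Y (\<rho> \<lbrakk>z, y\<rbrakk> v))
        = trace_on UNIV (\<lambda>v. Y (\<rho> z (\<rho> y v)) - Y (\<rho> y (\<rho> z v)))"
      by (simp add: action_bracket[OF act] lin_diff[OF Y(1)])
    also have "\<dots> = trace_on UNIV (\<lambda>v. Y (\<rho> z (\<rho> y v))) - trace_on UNIV (\<lambda>v. Y (\<rho> y (\<rho> z v)))"
      by (rule trace_on_diff) (use l in auto)
    also have "trace_on UNIV (\<lambda>v. Y (\<rho> y (\<rho> z v))) = trace_on UNIV (\<lambda>v. \<rho> z (Y (\<rho> y v)))"
      by (rule trace_on_comm[OF subspace_UNIV YL L2]) auto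
    also have "trace_on UNIV (\<lambda>v. Y (\<rho> z (\<rho> y v))) - trace_on UNIV (\<lambda>v. \<rho> z (Y (\<rho> y v)))
        = trace_on UNIV (\<lambda>v. Y (\<rho> z (\<rho> y v)) - \<rho> z (Y (\<rho> y v)))"
      by (rule trace_on_diff[symmetric]) (use l in auto)
    also have "\<dots> = trace_on UNIV (\<lambda>v. \<rho> (D z) (\<rho> y v))" by (simp add: D0)
    also have "\<dots> = 0" by (rule zero[OF y])
    finally show ?thesis by simp
  qed
  ultimately have "bracket_space UNIV S \<subseteq> ?K" by (intro bracket_space_least)
  then show "trace_on UNIV (\<lambda>v. Y (\<rho> x v)) = 0" using x by auto
qed

lemma gen_eigenspace_zero_inter:
  assumes "lin T" "v \<in> gen_eigenspace T c" "v \<in> gen_eigenspace T 0" "c \<noteq> 0"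
  shows "v = 0"
proof -
  obtain m where "((\<lambda>x. T x - 0 *s x) ^^ m) v = 0" using assms(3) by (auto simp: gen_eigenspace_def)
  then have "(T ^^ m) v = 0" by simp
  then show ?thesis using assms(2)
  proof (induction m arbitrary: v)
    case (Suc m)
    then have "T v = 0"
      using gen_eigenspace_closed(1)[OF assms(1)] by (simp add: funpow_Suc_right del: funpow.simps)
    then show ?case using eigenvector_in_gen_eigenspace[OF assms(1) Suc.prems(2), of 0] assms(4) by simp
  qed simp
qed

text \<open>Part of Engel's theorem. Let \<open>B\<close> be a solvable subalgebra of \<open>J\<close> of maximal dimension. If it were
  proper, Lie's theorem would give a common eigenvector \<open>v\<close> of \<open>B\<close> in the quotient of \<open>J\<close> by \<open>B\<close>. No
  \<open>ad b\<close> has a nonzero eigenvalue on \<open>J\<close>: an eigenvector would act on the module by shifting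
  generalized eigenspaces of \<open>\<rho> b\<close>, of which there is only one, and so it would act as zero. Hence
  the weight of \<open>v\<close> is zero, and the span of \<open>B\<close> and \<open>v\<close> is a larger solvable subalgebra.\<close>
theorem nilpotent_action_solvable:
  assumes act: "action \<rho>" and J: "subalgebra J"
    and faithful: "\<And>x. x \<in> J \<Longrightarrow> (\<And>v. \<rho> x v = 0) \<Longrightarrow> x = 0"
    and nil: "\<And>x. x \<in> J \<Longrightarrow> gen_eigenspace (\<rho> x) 0 = UNIV"
  shows "solvable_set J"
proof -
  note L1 = action_lin(1)[OF act] and L2 = action_lin(2)[OF act]
  have subJ: "subspace J" and brJ: "\<And>x y. x \<in> J \<Longrightarrow> y \<in> J \<Longrightarrow> \<lbrakk>x, y\<rbrakk> \<in> J"
    using J by (auto simp: subalgebra_def)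
  have no_eigenvector: "y = 0" if "b \<in> J" "y \<in> J" "\<lbrakk>b, y\<rbrakk> = c *s y" "c \<noteq> 0" for b y c
  proof (rule faithful[OF \<open>y \<in> J\<close>])
    fix v
    have "((\<lambda>y. \<lbrakk>b, y\<rbrakk> - c *s y) ^^ 1) y = 0" using that(3) by simp
    then have "y \<in> gen_eigenspace (bracket b) c" unfolding gen_eigenspace_def by blast
    moreover have "v \<in> gen_eigenspace (\<rho> b) 0" using nil that(1) by simp
    ultimately have "\<rho> y v \<in> gen_eigenspace (\<rho> b) c"
      using gen_eigenspace_action[OF act, of y b c v 0] by simp
    then show "\<rho> y v = 0"
      using gen_eigenspace_zero_inter[OF L2 _ _ that(4)] nil[OF that(1)] by blast
  qed
  define good where "good B \<longleftrightarrow> subalgebra B \<and> solvable_set B \<and> B \<subseteq> J" for B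
  have "derived_of {0} 0 \<subseteq> {0}" by simp
  then have "solvable_set {0}" unfolding solvable_set_def by (rule exI)
  moreover have "subalgebra {0}" by (simp add: subalgebra_def alternating)
  ultimately have good0: "good {0}" using subspace_0[OF subJ] by (simp add: good_def)
  have bound: "\<forall>B. good B \<longrightarrow> dim B < Suc dimension" by (simp add: less_Suc_eq_le dim_subset_UNIV)
  obtain B where B: "good B" and max: "\<And>B'. good B' \<Longrightarrow> dim B' \<le> dim B"
    using ex_has_greatest_nat[OF good0 bound] by auto
  have subB: "subspace B" and brB: "\<And>x y. x \<in> B \<Longrightarrow> y \<in> B \<Longrightarrow> \<lbrakk>x, y\<rbrakk> \<in> B"
    and solB: "solvable_set B" and BJ: "B \<subseteq> J"
    using B by (auto simp: good_def subalgebra_def)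
  have "B = J"
  proof (rule ccontr)
    assume "B \<noteq> J"
    then obtain j where j: "j \<in> J" "j \<notin> B" using BJ by blast
    obtain P where P: "lin P" "\<And>v. P v = 0 \<longleftrightarrow> v \<in> B" "\<And>v. v - P v \<in> B" "\<And>v. P (P v) = P v"
      using quotient_projection subB by metis
    define \<sigma> where "\<sigma> b v = P \<lbrakk>b, v\<rbrakk>" for b v
    have bil: "bilinear_product scale \<sigma>"
      unfolding bilinear_product_def \<sigma>_def using lin_comp[OF P(1)] bracket_lin by blast
    have PJ: "P v \<in> J" if "v \<in> J" for v
      using subspace_diff[OF subJ that, of "v - P v"] P(3) BJ by auto
    have PP: "P \<lbrakk>a, P z\<rbrakk> = P \<lbrakk>a, z\<rbrakk>" if "a \<in> B" for a z
    proof -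
      have "P \<lbrakk>a, z - P z\<rbrakk> = 0" using brB[OF that P(3)] P(2) by blast
      then show ?thesis by (simp add: bracket_simps lin_simps[OF P(1)])
    qed
    have C: "subspace (P ` J)" using module_hom.subspace_image[OF lin_hom[OF P(1)] subJ] .
    have "P j \<noteq> 0" using j P(2) by blast
    then have C0: "P ` J \<noteq> {0}" using j by blast
    have "subalgebra B" using B by (simp add: good_def)
    then obtain v \<omega> where v: "v \<in> P ` J" "v \<noteq> 0" "\<And>b. b \<in> B \<Longrightarrow> \<sigma> b v = \<omega> b *s v"
    proof (rule common_eigenvector[OF _ solB C C0 bil])
      show "\<sigma> b ` P ` J \<subseteq> P ` J" if "b \<in> B" for b
        unfolding \<sigma>_def using brJ PJ that BJ by blast
      show "\<sigma> \<lbrakk>a, b\<rbrakk> w = \<sigma> a (\<sigma> b w) - \<sigma> b (\<sigma> a w)" if "a \<in> B" "b \<in> B" for a b w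
        unfolding \<sigma>_def PP[OF that(1)] PP[OF that(2)] bracket_derivation[of a b w]
        by (simp add: lin_simps[OF P(1)])
    qed blast
    have vJ: "v \<in> J" and Pv: "P v = v" using v(1) PJ P(4) by auto
    have vB: "v \<notin> B" using Pv v(2) P(2)[of v] by auto
    have "\<lbrakk>b, v\<rbrakk> \<in> B" if b: "b \<in> B" for b
    proof -
      have bJ: "b \<in> J" using b BJ by blast
      have "\<omega> b = 0"
      proof (rule ccontr)
        assume w: "\<omega> b \<noteq> 0"
        let ?S = "\<lambda>x. \<lbrakk>b, x\<rbrakk> - \<omega> b *s x"
        have S: "lin ?S" by (rule lin_shift[OF bracket_lin(2)])
        have "?S ` B = B"
        proof (rule injective_endomorphism_onto[OF S subB])
          show "?S ` B \<subseteq> B" using brB[OF b] subspace_diff[OF subB] subspace_scale[OF subB] by blast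
          show "u = 0" if "u \<in> B" "?S u = 0" for u
            using no_eigenvector[OF bJ _ _ w, of u] that BJ by auto
        qed
        moreover have "P (?S v) = 0"
          using v(3)[OF b] Pv by (simp add: \<sigma>_def lin_simps[OF P(1)])
        then have "?S v \<in> B" using P(2) by blast
        ultimately obtain u where u: "u \<in> B" "?S v = ?S u" by (metis (no_types, lifting) imageE)
        then have "\<lbrakk>b, v - u\<rbrakk> = \<omega> b *s (v - u)" by (simp add: bracket_simps algebra_simps)
        moreover have "v - u \<in> J" using vJ u BJ subspace_diff[OF subJ] by blast
        ultimately have "v - u = 0" using no_eigenvector[OF bJ _ _ w] by blast
        then show False using vB u by simp
      qed
      then have "P \<lbrakk>b, v\<rbrakk> = 0" using v(3)[OF b] by (simp add: \<sigma>_def)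
      then show ?thesis using P(2) by blast
    qed
    note brv = this
    let ?B = "span (insert v B)"
    have sB: "span B = B" using subB by simp
    have br1: "\<lbrakk>x, y\<rbrakk> \<in> B" if x: "x \<in> ?B" and y: "y \<in> ?B" for x y
    proof -
      obtain k where k: "x - k *s v \<in> B" using x by (auto simp: span_breakdown_eq sB)
      obtain l where l: "y - l *s v \<in> B" using y by (auto simp: span_breakdown_eq sB)
      have "\<lbrakk>x, y\<rbrakk> = \<lbrakk>x - k *s v, y - l *s v\<rbrakk> + l *s \<lbrakk>x - k *s v, v\<rbrakk> - k *s \<lbrakk>y - l *s v, v\<rbrakk>"
        using bracket_anti[of y v] by (simp add: bracket_simps alternating algebra_simps)
      also have "\<dots> \<in> B"
        using brB[OF k l] brv[OF k] brv[OF l] subB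
        by (intro subspace_diff[OF subB] subspace_add[OF subB] subspace_scale[OF subB])
      finally show ?thesis .
    qed
    have BB: "B \<subseteq> ?B" using span_superset[of "insert v B"] by blast
    have "bracket_space ?B ?B \<subseteq> B" by (rule bracket_space_least[OF subB br1])
    then have "derived_of ?B (Suc k) \<subseteq> derived_of B k" for k
      unfolding derived_of_shift by (rule derived_of_mono)
    then have "solvable_set ?B" using solB unfolding solvable_set_def by (meson order_trans)
    moreover have "subalgebra ?B" using br1 BB unfolding subalgebra_def by auto
    moreover have "?B \<subseteq> J" using vJ BJ by (intro span_minimal subJ) auto
    ultimately have "good ?B" by (simp add: good_def)
    then have "dim ?B \<le> dim B" by (rule max)
    moreover have "v \<notin> span B" using vB unfolding sB .
    then have "dim (insert v B) = Suc (dim B)" by (simp add: dim_insert)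
    ultimately show False by simp
  qed
  then show ?thesis using solB by simp
qed


text \<open>The Casimir tensor \<open>\<Sum> d b \<otimes> b\<close> is killed by every element \<open>x\<close>. It is evaluated here under a
  bilinear map \<open>F\<close> instead of in a tensor product.\<close>
lemma casimir_invariant:
  assumes F: "bilinear_product scale F"
    and inv: "\<And>y z. \<beta> \<lbrakk>x, y\<rbrakk> z + \<beta> y \<lbrakk>x, z\<rbrakk> = 0"
    and J: "\<And>y. y \<in> J \<Longrightarrow> \<lbrakk>x, y\<rbrakk> \<in> J"
    and B: "B \<subseteq> J" "\<And>b. b \<in> B \<Longrightarrow> d b \<in> J"
    and expand: "\<And>y. y \<in> J \<Longrightarrow> y = (\<Sum>b\<in>B. \<beta> (d b) y *s b)"
      "\<And>y. y \<in> J \<Longrightarrow> y = (\<Sum>b\<in>B. \<beta> y b *s d b)"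
  shows "(\<Sum>b\<in>B. F \<lbrakk>x, d b\<rbrakk> b + F (d b) \<lbrakk>x, b\<rbrakk>) = 0"
proof -
  note F1 = bilinear_product_lin(1)[OF F] and F2 = bilinear_product_lin(2)[OF F]
  have 1: "F \<lbrakk>x, d b\<rbrakk> b = (\<Sum>c\<in>B. \<beta> \<lbrakk>x, d b\<rbrakk> c *s F (d c) b)" if "b \<in> B" for b
  proof -
    have "F \<lbrakk>x, d b\<rbrakk> b = F (\<Sum>c\<in>B. \<beta> \<lbrakk>x, d b\<rbrakk> c *s d c) b"
      using expand(2)[OF J[OF B(2)[OF that]]] by simp
    then show ?thesis by (simp add: lin_sum[OF F1] lin_scale[OF F1])
  qed
  have 2: "F (d b) \<lbrakk>x, b\<rbrakk> = (\<Sum>c\<in>B. \<beta> (d c) \<lbrakk>x, b\<rbrakk> *s F (d b) c)" if "b \<in> B" for b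
  proof -
    have "F (d b) \<lbrakk>x, b\<rbrakk> = F (d b) (\<Sum>c\<in>B. \<beta> (d c) \<lbrakk>x, b\<rbrakk> *s c)"
      using expand(1)[OF J, of b] B(1) that by auto
    then show ?thesis by (simp add: lin_sum[OF F2] lin_scale[OF F2])
  qed
  have "(\<Sum>b\<in>B. F \<lbrakk>x, d b\<rbrakk> b + F (d b) \<lbrakk>x, b\<rbrakk>)
      = (\<Sum>b\<in>B. \<Sum>c\<in>B. \<beta> \<lbrakk>x, d b\<rbrakk> c *s F (d c) b) + (\<Sum>b\<in>B. \<Sum>c\<in>B. \<beta> (d c) \<lbrakk>x, b\<rbrakk> *s F (d b) c)"
    using 1 2 by (simp add: sum.distrib)
  also have "(\<Sum>b\<in>B. \<Sum>c\<in>B. \<beta> (d c) \<lbrakk>x, b\<rbrakk> *s F (d b) c)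
      = (\<Sum>b\<in>B. \<Sum>c\<in>B. \<beta> (d b) \<lbrakk>x, c\<rbrakk> *s F (d c) b)"
    by (rule sum.swap)
  also have "(\<Sum>b\<in>B. \<Sum>c\<in>B. \<beta> \<lbrakk>x, d b\<rbrakk> c *s F (d c) b) + \<dots>
      = (\<Sum>b\<in>B. \<Sum>c\<in>B. (\<beta> \<lbrakk>x, d b\<rbrakk> c + \<beta> (d b) \<lbrakk>x, c\<rbrakk>) *s F (d c) b)"
    by (simp add: sum.distrib scale_left_distrib)
  also have "\<dots> = 0" by (simp add: inv)
  finally show ?thesis .
qed

section \<open>Reductive and nilpotent Lie algebras\<close>

lemma ideal_bracket_space: "ideal (bracket_space UNIV UNIV)"
  unfolding ideal_def using subspace_bracket_space bracket_in_bracket_space by blast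

text \<open>Complete reducibility passes from the whole algebra to an ideal \<open>S\<close> by the modular law.\<close>
lemma reductive_complement_in:
  assumes "reductive" "ideal K" "ideal S" "K \<subseteq> S"
  obtains J where "ideal J" "J \<subseteq> S" "K \<inter> J = {0}" "\<And>v. v \<in> S \<Longrightarrow> \<exists>a\<in>K. \<exists>b\<in>J. v = a + b"
proof -
  obtain J where "ideal J \<and> K \<inter> J = {0} \<and> {x + y | x y. x \<in> K \<and> y \<in> J} = UNIV"
    using assms(1)[unfolded reductive_def, rule_format, OF assms(2)] by (rule exE)
  then have J: "ideal J" "K \<inter> J = {0}" "{x + y | x y. x \<in> K \<and> y \<in> J} = UNIV"
    by simp_all
  have S: "subspace S" using assms(3) by (simp add: ideal_def)
  show thesis
  proof
    show "ideal (J \<inter> S)"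
      using J(1) assms(3) subspace_inter unfolding ideal_def by simp
    show "K \<inter> (J \<inter> S) = {0}" using J(2) subspace_0[OF S] by auto
    fix v assume v: "v \<in> S"
    have "v \<in> {x + y | x y. x \<in> K \<and> y \<in> J}" using J(3) by simp
    then obtain a b where ab: "v = a + b" "a \<in> K" "b \<in> J" by blast
    then have "v - a \<in> S" using subspace_diff[OF S v] assms(4) by blast
    then have "b \<in> S" using ab(1) by simp
    then show "\<exists>a\<in>K. \<exists>b\<in>J \<inter> S. v = a + b" using ab by blast
  qed simp
qed

text \<open>A complement of the derived algebra is central, which bounds its dimension. A complement \<open>K\<close> of the
  center satisfies \<open>[g, g] = [K, K] \<subseteq> K\<close>, because central summands drop out of brackets. By
  dimension \<open>K\<close> is the derived algebra itself, which is therefore perfect.\<close>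
lemma reductive_derived_algebra:
  assumes red: "reductive" and "dim center = 1"
  shows "bracket_space (bracket_space UNIV UNIV) (bracket_space UNIV UNIV) = bracket_space UNIV UNIV"
    and "dimension \<le> Suc (dim (bracket_space UNIV UNIV))"
proof -
  let ?S = "bracket_space UNIV UNIV"
  have dimU: "dim UNIV = dimension" by (simp add: dimension_def)
  have sum_dim: "dimension = dim K + dim J"
    if "ideal K" "ideal J" "K \<inter> J = {0}" "\<And>v. v \<in> UNIV \<Longrightarrow> \<exists>a\<in>K. \<exists>b\<in>J. v = a + b" for K J
  proof -
    have "{x + y | x y. x \<in> K \<and> y \<in> J} = UNIV" using that(4) by blast
    then show ?thesis
      using dim_sums_Int[of K J] that(1-3) dimU by (simp add: ideal_def)
  qed
  have idU: "ideal UNIV" by (simp add: ideal_def)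
  obtain J where J: "ideal J" "?S \<inter> J = {0}" "\<And>v. v \<in> UNIV \<Longrightarrow> \<exists>a\<in>?S. \<exists>b\<in>J. v = a + b"
    using reductive_complement_in[OF red ideal_bracket_space idU] by (metis subset_UNIV)
  have "J \<subseteq> center"
  proof
    fix y assume y: "y \<in> J"
    have "\<lbrakk>x, y\<rbrakk> \<in> ?S \<inter> J" for x
      using y J(1) bracket_in_bracket_space[of x UNIV y UNIV] by (auto simp: ideal_def)
    then have "\<lbrakk>x, y\<rbrakk> = 0" for x using J(2) by blast
    then show "y \<in> center" using bracket_anti[of y] by (simp add: center_def)
  qed
  then have "dim J \<le> 1" using dim_subset assms(2) by metis
  then show dS: "dimension \<le> Suc (dim ?S)"
    using sum_dim[OF ideal_bracket_space J(1,2,3)] by simp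
  have idZ: "ideal center"
    unfolding ideal_def
  proof (intro conjI allI ballI)
    show "subspace center" by (auto simp: center_def subspace_def bracket_simps)
    show "\<lbrakk>x, y\<rbrakk> \<in> center" if "y \<in> center" for x y
      using that bracket_anti[of x y] by (simp add: center_def bracket_simps)
  qed
  obtain K where K: "ideal K" "center \<inter> K = {0}" "\<And>v. v \<in> UNIV \<Longrightarrow> \<exists>a\<in>center. \<exists>b\<in>K. v = a + b"
    using reductive_complement_in[OF red idZ idU] by (metis subset_UNIV)
  have SK: "?S \<subseteq> bracket_space K K"
  proof (rule bracket_space_least[OF subspace_bracket_space])
    fix x y
    obtain a b where x: "a \<in> center" "b \<in> K" "x = a + b" using K(3) by blast
    obtain a' b' where y: "a' \<in> center" "b' \<in> K" "y = a' + b'" using K(3) by blast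
    have "\<lbrakk>b, a'\<rbrakk> = 0" using y(1) bracket_anti[of b a'] by (simp add: center_def)
    then have "\<lbrakk>x, y\<rbrakk> = \<lbrakk>b, b'\<rbrakk>" using x y by (simp add: bracket_simps center_def)
    then show "\<lbrakk>x, y\<rbrakk> \<in> bracket_space K K" using x y bracket_in_bracket_space by simp
  qed
  have subK: "subspace K" using K(1) by (simp add: ideal_def)
  have KK: "bracket_space K K \<subseteq> K"
    using K(1) by (intro bracket_space_least subK) (auto simp: ideal_def)
  have "dimension = 1 + dim K" using sum_dim[OF idZ K(1,2,3)] assms(2) by simp
  then have "dim K \<le> dim ?S" using dS by simp
  then have "?S = K"
    using subspace_dim_equal[OF subspace_bracket_space subK] SK KK by (meson order_trans)
  then show "bracket_space ?S ?S = ?S" using SK KK by blast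
qed

lemma nilpotent_if_flag:
  assumes "W 0 = {0}" "W n = UNIV" "\<And>i. subspace (W i)"
    and "\<And>i x v. v \<in> W (Suc i) \<Longrightarrow> \<lbrakk>x, v\<rbrakk> \<in> W i"
  shows nilpotent
proof -
  have "lower_central_series k \<subseteq> W (n - k)" if "k \<le> n" for k
    using that
  proof (induction k)
    case 0
    then show ?case by (simp add: assms(2))
  next
    case (Suc k)
    then have "n - k = Suc (n - Suc k)" by simp
    then have "lower_central_series k \<subseteq> W (Suc (n - Suc k))" using Suc by simp
    then have "bracket_space UNIV (lower_central_series k) \<subseteq> W (n - Suc k)"
      using assms(4) by (intro bracket_space_least[OF assms(3)]) blast
    then show ?case by simp
  qed
  then have "lower_central_series n \<subseteq> {0}" using assms(1) by (metis diff_self_eq_0 order_refl)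
  moreover have "subspace (lower_central_series n)"
    by (cases n) (simp_all add: subspace_bracket_space)
  ultimately have "lower_central_series n = {0}" using subspace_0 by blast
  then show ?thesis unfolding nilpotent_def by blast
qed

lemma trace_bracket_bracket: "trace_on UNIV (bracket \<lbrakk>x, y\<rbrakk>) = 0"
proof -
  have eq: "bracket \<lbrakk>x, y\<rbrakk> = (\<lambda>v. \<lbrakk>x, \<lbrakk>y, v\<rbrakk>\<rbrakk> - \<lbrakk>y, \<lbrakk>x, v\<rbrakk>\<rbrakk>)"
    by (rule ext) (simp add: bracket_derivation[of x y])
  show ?thesis
    unfolding eq
    using trace_on_diff[OF subspace_UNIV, of "\<lambda>v. \<lbrakk>x, \<lbrakk>y, v\<rbrakk>\<rbrakk>" "\<lambda>v. \<lbrakk>y, \<lbrakk>x, v\<rbrakk>\<rbrakk>"]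
      trace_on_comm[OF subspace_UNIV bracket_lin(2)[of x] bracket_lin(2)[of y]]
    by (simp add: lin_comp[OF bracket_lin(2) bracket_lin(2)])
qed

end

section \<open>Post-Lie structures\<close>

locale post_lie_algebra = complex_space scale basis +
    g: fin_lie_algebra scale basis brg + n: fin_lie_algebra scale basis brn
  for scale :: "complex \<Rightarrow> 'v::ab_group_add \<Rightarrow> 'v" (infixr \<open>*s\<close> 75)
    and basis :: "'v set" and brg brn :: "'v \<Rightarrow> 'v \<Rightarrow> 'v" +
  fixes p :: "'v \<Rightarrow> 'v \<Rightarrow> 'v" (infixl \<open>\<cdot>\<close> 70)
  assumes post_lie: "post_lie_structure scale brg brn p"
begin

lemma bilinear_p: "bilinear_product scale p"
  using post_lie by (simp add: post_lie_structure_def)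

lemmas p_lin = bilinear_product_lin[OF bilinear_p]
lemmas p_simps = lin_simps[OF p_lin(1)] lin_simps[OF p_lin(2)]
lemmas n_simps = lin_simps[OF n.bracket_lin(1)] lin_simps[OF n.bracket_lin(2)]

lemma brg_eq: "brg x y = x \<cdot> y - y \<cdot> x + brn x y"
proof -
  have "x \<cdot> y - y \<cdot> x = brg x y - brn x y" using post_lie by (simp add: post_lie_structure_def)
  then show ?thesis by simp
qed

lemma action_p: "g.action p"
  using post_lie by (simp add: post_lie_structure_def g.action_def)

lemma p_brg: "brg x y \<cdot> z = x \<cdot> (y \<cdot> z) - y \<cdot> (x \<cdot> z)"
  using g.action_bracket[OF action_p] .

lemma p_brn: "x \<cdot> brn y z = brn (x \<cdot> y) z + brn y (x \<cdot> z)"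
  using post_lie by (simp add: post_lie_structure_def)

lemma derivation_p: "n.derivation (p x)"
  unfolding n.derivation_def using p_lin(2) p_brn by blast

abbreviation tr :: "('v \<Rightarrow> 'v) \<Rightarrow> complex"
  where "tr \<equiv> trace_on UNIV"

lemma tr_add: "lin S \<Longrightarrow> lin T \<Longrightarrow> tr (\<lambda>v. S v + T v) = tr S + tr T"
  and tr_diff: "lin S \<Longrightarrow> lin T \<Longrightarrow> tr (\<lambda>v. S v - T v) = tr S - tr T"
  and tr_scale: "lin T \<Longrightarrow> tr (\<lambda>v. c *s T v) = c * tr T"
  and tr_comm: "lin S \<Longrightarrow> lin T \<Longrightarrow> tr (\<lambda>v. S (T v)) = tr (\<lambda>v. T (S v))"
  by (simp_all add: trace_on_add trace_on_diff trace_on_scale trace_on_comm)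

lemma functional_zero_on_bracket_space:
  assumes "x \<in> g.bracket_space A B" "f 0 = 0" "\<And>x y. f (x + y) = f x + f y"
    "\<And>c x. f (c *s x) = c * f x" "\<And>a b. a \<in> A \<Longrightarrow> b \<in> B \<Longrightarrow> f (brg a b) = (0::complex)"
  shows "f x = 0"
proof -
  have "g.bracket_space A B \<subseteq> {x. f x = 0}"
    by (rule g.bracket_space_least) (use assms in \<open>auto simp: subspace_def\<close>)
  then show ?thesis using assms(1) by blast
qed

text \<open>Let \<open>R z\<close> be the right multiplication by \<open>z\<close>. The module identity expresses \<open>R (x \<cdot> z)\<close> as
  \<open>R z R x - R z (ad x)\<close> plus a commutator, and the derivation identity expresses \<open>R {x, z}\<close> as
  \<open>ad x R z - ad z R x\<close>. In the trace of \<open>R [x, z]\<close> all these terms cancel.\<close>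
lemma trace_right_mult_zero:
  assumes "w \<in> g.bracket_space UNIV UNIV"
  shows "tr (\<lambda>v. v \<cdot> w) = 0"
proof (rule functional_zero_on_bracket_space[OF assms])
  fix x z
  note lc = lin_comp[OF p_lin(1) p_lin(1)] lin_comp[OF p_lin(1) p_lin(2)]
    lin_comp[OF p_lin(2) p_lin(1)] lin_comp[OF p_lin(1) n.bracket_lin(2)]
    lin_comp[OF n.bracket_lin(2) p_lin(1)]
  have 1: "tr (\<lambda>v. v \<cdot> (x \<cdot> z)) = tr (\<lambda>v. v \<cdot> x \<cdot> z) - tr (\<lambda>v. brn x v \<cdot> z)" for x z
  proof -
    have "v \<cdot> (x \<cdot> z) = ((x \<cdot> (v \<cdot> z) - (x \<cdot> v) \<cdot> z) + (v \<cdot> x) \<cdot> z) - brn x v \<cdot> z" for v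
      using p_brg[of x v z] unfolding brg_eq by (simp add: p_simps algebra_simps)
    then have "tr (\<lambda>v. v \<cdot> (x \<cdot> z))
        = tr (\<lambda>v. x \<cdot> (v \<cdot> z)) - tr (\<lambda>v. (x \<cdot> v) \<cdot> z) + tr (\<lambda>v. (v \<cdot> x) \<cdot> z) - tr (\<lambda>v. brn x v \<cdot> z)"
      using lc by (simp add: tr_add tr_diff lin_plus lin_minus)
    moreover have "tr (\<lambda>v. x \<cdot> (v \<cdot> z)) = tr (\<lambda>v. (x \<cdot> v) \<cdot> z)"
      by (rule tr_comm[OF p_lin(2) p_lin(1)])
    ultimately show ?thesis by simp
  qed
  have 2: "tr (\<lambda>v. v \<cdot> brn x z) = tr (\<lambda>v. brn x (v \<cdot> z)) - tr (\<lambda>v. brn z (v \<cdot> x))"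
  proof -
    have "v \<cdot> brn x z = brn x (v \<cdot> z) - brn z (v \<cdot> x)" for v
      using n.bracket_anti[of "v \<cdot> x" z] by (simp add: p_brn)
    then show ?thesis using lc by (simp add: tr_diff)
  qed
  have "tr (\<lambda>v. v \<cdot> brg x z) = tr (\<lambda>v. v \<cdot> (x \<cdot> z)) - tr (\<lambda>v. v \<cdot> (z \<cdot> x)) + tr (\<lambda>v. v \<cdot> brn x z)"
    unfolding brg_eq by (simp add: p_simps tr_add tr_diff lin_minus p_lin(1))
  moreover have "tr (\<lambda>v. v \<cdot> x \<cdot> z) = tr (\<lambda>v. v \<cdot> z \<cdot> x)"
    by (rule tr_comm[OF p_lin(1) p_lin(1)])
  moreover have "tr (\<lambda>v. brn x v \<cdot> z) = tr (\<lambda>v. brn x (v \<cdot> z))" for x z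
    by (rule tr_comm[OF p_lin(1) n.bracket_lin(2)])
  ultimately show "tr (\<lambda>v. v \<cdot> brg x z) = 0" by (simp add: 1 2)
qed (simp_all add: p_simps tr_add tr_scale trace_on_zero p_lin(1))

lemma trace_brn_zero:
  assumes "w \<in> g.bracket_space UNIV UNIV"
  shows "tr (brn w) = 0"
proof (rule functional_zero_on_bracket_space[OF assms])
  fix x z
  have p0: "tr (brn (x \<cdot> z)) = 0" for x z
  proof -
    have "brn (x \<cdot> z) = (\<lambda>v. x \<cdot> brn z v - brn z (x \<cdot> v))" by (simp add: p_brn)
    then show ?thesis
      using tr_comm[OF p_lin(2) n.bracket_lin(2), of x z]
      by (simp add: tr_diff lin_comp[OF p_lin(2) n.bracket_lin(2)] lin_comp[OF n.bracket_lin(2) p_lin(2)])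
  qed
  have "brn (brg x z) = (\<lambda>v. brn (x \<cdot> z) v - brn (z \<cdot> x) v + brn (brn x z) v)"
    unfolding brg_eq by (rule ext) (simp add: n_simps)
  then show "tr (brn (brg x z)) = 0"
    using n.trace_bracket_bracket[of x z]
    by (simp add: tr_add tr_diff lin_minus n.bracket_lin(2) p0)
next
  have eq: "brn (x + y) = (\<lambda>v. brn x v + brn y v)" "brn (c *s x) = (\<lambda>v. c *s brn x v)"
    "brn 0 = (\<lambda>v. 0)" for x y c
    by (auto simp: n_simps)
  show "tr (brn 0) = 0" unfolding eq by (simp add: trace_on_zero)
  show "tr (brn (x + y)) = tr (brn x) + tr (brn y)" for x y
    unfolding eq by (simp add: tr_add n.bracket_lin(2))
  show "tr (brn (c *s x)) = c * tr (brn x)" for x c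
    unfolding eq by (simp add: tr_scale n.bracket_lin(2))
qed

definition trace_form :: "'v \<Rightarrow> 'v \<Rightarrow> complex"
  where "trace_form x y = tr (\<lambda>v. x \<cdot> (y \<cdot> v))"

lemma trace_form_bilinear:
  "trace_form (x + x') y = trace_form x y + trace_form x' y" "trace_form (c *s x) y = c * trace_form x y"
  "trace_form x (y + y') = trace_form x y + trace_form x y'" "trace_form x (c *s y) = c * trace_form x y"
  unfolding trace_form_def using lin_comp[OF p_lin(2) p_lin(2)]
  by (simp_all add: p_simps tr_add tr_scale)

lemma trace_form_sym: "trace_form x y = trace_form y x"
  unfolding trace_form_def by (rule tr_comm[OF p_lin(2) p_lin(2)])

lemma trace_form_invariant: "trace_form (brg x y) z + trace_form y (brg x z) = 0"
proof -
  note l2 = lin_comp[OF p_lin(2) p_lin(2)]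
  note l3 = lin_comp[OF p_lin(2) l2]
  have "trace_form (brg x y) z = tr (\<lambda>v. x \<cdot> (y \<cdot> (z \<cdot> v))) - tr (\<lambda>v. y \<cdot> (x \<cdot> (z \<cdot> v)))"
    unfolding trace_form_def p_brg by (rule tr_diff[OF l3 l3])
  moreover have "trace_form y (brg x z) = tr (\<lambda>v. y \<cdot> (x \<cdot> (z \<cdot> v))) - tr (\<lambda>v. y \<cdot> (z \<cdot> (x \<cdot> v)))"
    unfolding trace_form_def p_brg using tr_diff[OF l3 l3] by (simp add: p_simps)
  moreover have "tr (\<lambda>v. x \<cdot> (y \<cdot> (z \<cdot> v))) = tr (\<lambda>v. y \<cdot> (z \<cdot> (x \<cdot> v)))"
    by (rule tr_comm[OF p_lin(2) l2])
  ultimately show ?thesis by simp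
qed

text \<open>For \<open>n\<close> abelian this says that the right multiplication by \<open>w\<close> is the Casimir operator: the identity
  map of \<open>g\<close> is a cocycle with values in the module, and \<open>w\<close> is the vector of Whitehead's argument. In
  general the bracket of \<open>n\<close> contributes the two other terms.\<close>
lemma casimir_right_mult:
  assumes J: "g.ideal J" and B: "B \<subseteq> J" "\<And>b. b \<in> B \<Longrightarrow> d b \<in> J"
    and expand: "\<And>y. y \<in> J \<Longrightarrow> y = (\<Sum>b\<in>B. trace_form (d b) y *s b)"
      "\<And>y. y \<in> J \<Longrightarrow> y = (\<Sum>b\<in>B. trace_form y b *s d b)"
  defines "w \<equiv> \<Sum>b\<in>B. d b \<cdot> b"
  shows "x \<cdot> w = (\<Sum>b\<in>B. d b \<cdot> (b \<cdot> x)) + (\<Sum>b\<in>B. brn b (d b \<cdot> x)) + brn w x"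
proof -
  have "x \<cdot> (d b \<cdot> b) = (brg x (d b) \<cdot> b + d b \<cdot> brg x b) + d b \<cdot> (b \<cdot> x) + brn b (d b \<cdot> x)
      + brn (d b \<cdot> b) x" for b
  proof -
    have "x \<cdot> (d b \<cdot> b) = brg x (d b) \<cdot> b + d b \<cdot> (x \<cdot> b)" by (simp add: p_brg)
    moreover have "x \<cdot> b = brg x b + b \<cdot> x - brn x b" by (simp add: brg_eq)
    moreover have "d b \<cdot> brn x b = - brn b (d b \<cdot> x) - brn (d b \<cdot> b) x"
      using n.bracket_anti[of "d b \<cdot> x" b] n.bracket_anti[of x "d b \<cdot> b"] by (simp add: p_brn)
    ultimately show ?thesis by (simp add: p_simps)
  qed
  then have "x \<cdot> w = (\<Sum>b\<in>B. brg x (d b) \<cdot> b + d b \<cdot> brg x b) + (\<Sum>b\<in>B. d b \<cdot> (b \<cdot> x))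
      + (\<Sum>b\<in>B. brn b (d b \<cdot> x)) + (\<Sum>b\<in>B. brn (d b \<cdot> b) x)"
    unfolding w_def by (simp add: lin_sum[OF p_lin(2)] sum.distrib)
  moreover have "(\<Sum>b\<in>B. brg x (d b) \<cdot> b + d b \<cdot> brg x b) = 0"
    by (rule g.casimir_invariant[where \<beta>=trace_form and J=J])
       (use bilinear_p trace_form_invariant J B expand in \<open>auto simp: g.ideal_def\<close>)
  moreover have "(\<Sum>b\<in>B. brn (d b \<cdot> b) x) = brn w x"
    unfolding w_def by (simp add: lin_sum[OF n.bracket_lin(1)])
  ultimately show ?thesis by simp
qed

abbreviation derived_g :: "'v set"
  where "derived_g \<equiv> g.bracket_space UNIV UNIV"

text \<open>On a complement \<open>J\<close> of the radical within the derived algebra the form is nondegenerate. For dual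
  bases of \<open>J\<close> the right multiplication by the element \<open>w\<close> of the previous lemma has trace \<open>dim J\<close>,
  as the flag kills the contribution of the bracket of \<open>n\<close>. But \<open>w\<close> lies in the derived algebra,
  where the traces of right multiplications vanish.\<close>
lemma trace_form_trivial:
  assumes red: "g.reductive" and perfect: "g.bracket_space derived_g derived_g = derived_g"
    and flag: "W 0 = {0}" "W n = UNIV" "\<And>i. subspace (W i)" "\<And>i. W i \<subseteq> W (Suc i)"
      "\<And>i x. p x ` W i \<subseteq> W i" "\<And>i s v. s \<in> derived_g \<Longrightarrow> v \<in> W (Suc i) \<Longrightarrow> brn s v \<in> W i"
    and into: "\<And>x y. x \<cdot> y \<in> derived_g"
    and x: "x \<in> derived_g"
  shows "trace_form z x = 0"
proof -
  have subS: "subspace derived_g" by (rule g.subspace_bracket_space)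
  have brS: "brg a b \<in> derived_g" for a b by (rule g.bracket_in_bracket_space) auto
  define K where "K = {x \<in> derived_g. \<forall>y\<in>derived_g. trace_form x y = 0}"
  have t0: "trace_form 0 y = 0" for y using trace_form_bilinear(2)[of 0 0 y] by simp
  have idK: "g.ideal K"
    unfolding g.ideal_def
  proof (intro conjI allI ballI)
    show "subspace K"
      using subS by (auto simp: K_def subspace_def trace_form_bilinear t0)
    fix z x assume x: "x \<in> K"
    have "trace_form (brg z x) y = 0" for y
      using trace_form_invariant[of z x y] x brS by (simp add: K_def)
    then show "brg z x \<in> K" using brS by (simp add: K_def)
  qed
  obtain J where J: "g.ideal J" "J \<subseteq> derived_g" "K \<inter> J = {0}" "\<And>v. v \<in> derived_g \<Longrightarrow> \<exists>a\<in>K. \<exists>b\<in>J. v = a + b"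
    using g.reductive_complement_in[OF red idK g.ideal_bracket_space] K_def by blast
  have subJ: "subspace J" using J(1) by (simp add: g.ideal_def)
  have nondeg: "j = 0" if j: "j \<in> J" "\<And>y. y \<in> J \<Longrightarrow> trace_form j y = 0" for j
  proof -
    have "trace_form j y = 0" if y: "y \<in> derived_g" for y
    proof -
      obtain a b where ab: "a \<in> K" "b \<in> J" "y = a + b" using J(4)[OF y] by blast
      have "trace_form j a = 0" using ab(1) j(1) J(2) trace_form_sym[of j a] by (auto simp: K_def)
      then show ?thesis using j(2)[OF ab(2)] ab(3) by (simp add: trace_form_bilinear)
    qed
    then have "j \<in> K" using j(1) J(2) by (auto simp: K_def)
    then show ?thesis using j(1) J(3) by blast
  qed
  obtain B d where B: "finite B" "independent B" "span B = J" "B \<subseteq> J" "\<And>b. b \<in> B \<Longrightarrow> d b \<in> J"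
    "\<And>b. b \<in> B \<Longrightarrow> trace_form (d b) b = 1"
    "\<And>x. x \<in> J \<Longrightarrow> x = (\<Sum>b\<in>B. trace_form (d b) x *s b)"
    "\<And>x. x \<in> J \<Longrightarrow> x = (\<Sum>b\<in>B. trace_form x b *s d b)"
  proof (rule dual_basis_exists[where \<beta>=trace_form, OF subJ trace_form_bilinear])
    show "j = 0" if "j \<in> J" "\<And>y. y \<in> J \<Longrightarrow> trace_form j y = 0" for j
      using nondeg that by blast
  qed blast
  define w where "w = (\<Sum>b\<in>B. d b \<cdot> b)"
  have wS: "w \<in> derived_g" unfolding w_def by (rule subspace_sum[OF subS into])
  have linC: "lin (\<lambda>v. d b \<cdot> (b \<cdot> v))" and linN: "lin (\<lambda>v. brn b (d b \<cdot> v))" for b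
    by (rule lin_comp[OF p_lin(2) p_lin(2)], rule lin_comp[OF n.bracket_lin(2) p_lin(2)])
  have nil: "tr (\<lambda>v. brn b (d b \<cdot> v)) = 0" if "b \<in> B" for b
  proof -
    have "b \<in> derived_g" using that B(4) J(2) by blast
    then have "(\<lambda>v. brn b (d b \<cdot> v)) ` W (Suc i) \<subseteq> W i" for i
      using flag(5)[of "d b" "Suc i"] flag(6) by blast
    then have "trace_on (W n) (\<lambda>v. brn b (d b \<cdot> v)) = 0"
      by (intro trace_on_flag[where W=W] flag(1,3,4) linN)
    then show ?thesis by (simp add: flag(2))
  qed
  have "(\<lambda>v. v \<cdot> w) = (\<lambda>v. (\<Sum>b\<in>B. d b \<cdot> (b \<cdot> v)) + (\<Sum>b\<in>B. brn b (d b \<cdot> v)) + brn w v)"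
    unfolding w_def by (rule ext) (rule casimir_right_mult[OF J(1) B(4,5,7,8)])
  then have "tr (\<lambda>v. v \<cdot> w)
      = tr (\<lambda>v. \<Sum>b\<in>B. d b \<cdot> (b \<cdot> v)) + tr (\<lambda>v. \<Sum>b\<in>B. brn b (d b \<cdot> v)) + tr (brn w)"
    by (simp add: tr_add lin_plus lin_setsum linC linN n.bracket_lin(2))
  also have "tr (\<lambda>v. \<Sum>b\<in>B. brn b (d b \<cdot> v)) = (\<Sum>b\<in>B. tr (\<lambda>v. brn b (d b \<cdot> v)))"
    by (rule trace_on_sum) (use linN in auto)
  also have "tr (\<lambda>v. \<Sum>b\<in>B. d b \<cdot> (b \<cdot> v)) = (\<Sum>b\<in>B. trace_form (d b) b)"
    unfolding trace_form_def by (rule trace_on_sum) (use linC in auto)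
  finally have "of_nat (card B) = (0::complex)"
    by (simp add: trace_right_mult_zero[OF wS] trace_brn_zero[OF wS] nil B(6))
  then have "J = {0}" using B(1,3) by auto
  then have SK: "y \<in> K" if "y \<in> derived_g" for y using J(4)[OF that] by auto
  have "x \<in> g.bracket_space derived_g derived_g" using x perfect by simp
  then show ?thesis
  proof (rule functional_zero_on_bracket_space)
    show "trace_form z (brg a b) = 0" if "a \<in> derived_g" "b \<in> derived_g" for a b
    proof -
      (* Only the vanishing on pairs in the derived algebra is known; invariance and perfectness
         extend it to arbitrary z in the other argument. *)
      have "trace_form (brg a z) b = 0" using SK[OF brS] that by (simp add: K_def)
      then show ?thesis using trace_form_invariant[of a z b] by simp
    qed
    show "trace_form z 0 = 0" using t0 trace_form_sym by metis
  qed (simp_all add: trace_form_bilinear)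
qed

text \<open>A complement of the kernel of the action within the derived algebra is a perfect ideal that acts
  faithfully, and by nilpotent operators because of Cartan's criterion. It is solvable as well, hence
  zero.\<close>
lemma derived_algebra_acts_trivially:
  assumes red: "g.reductive" and perfect: "g.bracket_space derived_g derived_g = derived_g"
    and zero: "\<And>x z. x \<in> derived_g \<Longrightarrow> trace_form z x = 0"
    and x: "x \<in> derived_g"
  shows "x \<cdot> v = 0"
proof -
  have subS: "subspace derived_g" by (rule g.subspace_bracket_space)
  have brS: "brg a b \<in> derived_g" for a b by (rule g.bracket_in_bracket_space) auto
  have nil: "gen_eigenspace (p x) 0 = UNIV" if "x \<in> derived_g" for x
  proof (rule g.cartan_nilpotent[OF action_p])
    show "tr (\<lambda>v. z \<cdot> (y \<cdot> v)) = 0" if "y \<in> derived_g" for z y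
      using zero[OF that] by (simp add: trace_form_def)
    show "x \<in> g.bracket_space UNIV derived_g"
      using that perfect g.bracket_space_mono[of derived_g UNIV derived_g derived_g] by auto
  qed
  define K where "K = {x \<in> derived_g. \<forall>v. x \<cdot> v = 0}"
  have idK: "g.ideal K"
    unfolding g.ideal_def
  proof (intro conjI allI ballI)
    show "subspace K" using subS by (auto simp: K_def subspace_def p_simps)
    show "brg z x \<in> K" if "x \<in> K" for z x
      using that brS by (simp add: K_def p_brg p_simps)
  qed
  have subK: "subspace K" using idK by (simp add: g.ideal_def)
  obtain J where J: "g.ideal J" "J \<subseteq> derived_g" "K \<inter> J = {0}" "\<And>v. v \<in> derived_g \<Longrightarrow> \<exists>a\<in>K. \<exists>b\<in>J. v = a + b"
    using g.reductive_complement_in[OF red idK g.ideal_bracket_space] K_def by blast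
  have subJ: "subspace J" and algJ: "g.subalgebra J"
    using J(1) by (auto simp: g.ideal_def g.subalgebra_def)
  have "g.solvable_set J"
  proof (rule g.nilpotent_action_solvable[OF action_p algJ])
    show "x = 0" if "x \<in> J" "\<And>v. x \<cdot> v = 0" for x
      using that J(2,3) by (auto simp: K_def)
    show "gen_eigenspace (p x) 0 = UNIV" if "x \<in> J" for x
      using nil that J(2) by blast
  qed
  moreover have "J \<subseteq> g.bracket_space J J"
  proof
    let ?J' = "g.bracket_space J J"
    have JJ: "?J' \<subseteq> J"
      using J(1) by (intro g.bracket_space_least subJ) (simp add: g.ideal_def)
    have "g.bracket_space derived_g derived_g \<subseteq> {a + b | a b. a \<in> K \<and> b \<in> ?J'}"
    proof (rule g.bracket_space_least[OF subspace_sums[OF subK g.subspace_bracket_space]])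
      fix x y assume "x \<in> derived_g" "y \<in> derived_g"
      then obtain a b a' b' where x: "a \<in> K" "b \<in> J" "x = a + b" and y: "a' \<in> K" "b' \<in> J" "y = a' + b'"
        using J(4) by metis
      have K1: "brg u k \<in> K" if "k \<in> K" for u k using idK that by (simp add: g.ideal_def)
      have K2: "brg k u \<in> K" if "k \<in> K" for u k
        using K1[OF that, of u] g.bracket_anti[of k u] subspace_neg[OF subK] by simp
      have "brg x y = (brg a y + brg b a') + brg b b'"
        using x y by (simp add: g.bracket_simps)
      moreover have "brg a y + brg b a' \<in> K"
        using K1 K2 x y subspace_add[OF subK] by blast
      moreover have "brg b b' \<in> ?J'" using x y g.bracket_in_bracket_space by blast
      ultimately show "brg x y \<in> {a + b | a b. a \<in> K \<and> b \<in> ?J'}" by blast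
    qed
    then have decomposition: "derived_g \<subseteq> {a + b | a b. a \<in> K \<and> b \<in> ?J'}" by (simp only: perfect)
    fix j assume j: "j \<in> J"
    then have "j \<in> {a + b | a b. a \<in> K \<and> b \<in> ?J'}" using decomposition J(2) by blast
    then obtain a b where ab: "a \<in> K" "b \<in> ?J'" "j = a + b" by blast
    have "j - b \<in> J" using subspace_diff[OF subJ j] ab(2) JJ by blast
    then have "a \<in> K \<inter> J" using ab by simp
    then show "j \<in> ?J'" using ab J(3) by simp
  qed
  ultimately have "J \<subseteq> {0}" using g.perfect_solvable_trivial by blast
  then have "x \<in> K" using J(4)[OF x] by auto
  then show ?thesis by (simp add: K_def)
qed

text \<open>The span \<open>I\<close> of the images of all left multiplications and all inner derivations of \<open>n\<close> acts
  nilpotently on \<open>n\<close> and contains the derived algebra of \<open>g\<close>. Unless \<open>n\<close> is nilpotent, it is a proper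
  subspace. Being of codimension one
  it coincides with that derived algebra, to which the two previous lemmas apply.\<close>
theorem reductive_solvable_imp_nilpotent:
  assumes red: "g.reductive" and dim1: "dim g.center = 1" and sol: "n.solvable"
  shows "n.nilpotent"
proof (rule ccontr)
  assume non_nilpotent: "\<not> n.nilpotent"
  note reductive_facts = g.reductive_derived_algebra[OF red dim1]
  have subS: "subspace derived_g" by (rule g.subspace_bracket_space)
  define \<D> where "\<D> = range p \<union> range brn"
  have der: "n.derivation D" if "D \<in> \<D>" for D
    using that derivation_p n.derivation_bracket by (auto simp: \<D>_def)
  have inner: "brn u \<in> \<D>" for u by (simp add: \<D>_def)
  obtain W n where W: "W 0 = {0}" "W n = UNIV" "\<And>i. subspace (W i)" "\<And>i. W i \<subseteq> W (Suc i)"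
    "\<And>i D. D \<in> \<D> \<Longrightarrow> D ` W i \<subseteq> W i"
    "\<And>i D y v. D \<in> \<D> \<Longrightarrow> v \<in> W (Suc i) \<Longrightarrow> brn (D y) v \<in> W i"
    using n.solvable_flag[OF sol der inner] by metis
  define I where "I = span {D y | D y. D \<in> \<D>}"
  have subI: "subspace I" by (simp add: I_def)
  have pI: "x \<cdot> y \<in> I" for x y unfolding I_def \<D>_def by (intro span_base) blast
  have nI: "brn x y \<in> I" for x y unfolding I_def \<D>_def by (intro span_base) blast
  have I_nil: "brn y v \<in> W i" if y: "y \<in> I" and v: "v \<in> W (Suc i)" for y v i
    using y unfolding I_def
    by (rule span_closed[OF _ n.bracket_lin(1) W(3)]) (use W(6) v in blast)
  have SI: "derived_g \<subseteq> I"
  proof (rule g.bracket_space_least[OF subI])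
    show "brg x y \<in> I" for x y
      unfolding brg_eq by (intro subspace_add[OF subI] subspace_diff[OF subI] pI nI)
  qed
  have "I \<noteq> UNIV"
    using n.nilpotent_if_flag[OF W(1-3)] I_nil non_nilpotent by blast
  then have "dim I < dimension"
    using dim_psubset[of I UNIV] span_eq_iff[THEN iffD2, OF subI]
    by (simp only: span_UNIV dim_UNIV dimension_def) blast
  then have "dim I \<le> dim derived_g" using reductive_facts(2) by simp
  then have IS: "I = derived_g" using subspace_dim_equal[OF subS subI SI] by simp
  have zero: "trace_form z x = 0" if "x \<in> derived_g" for x z
  proof (rule trace_form_trivial[OF red reductive_facts(1) W(1-4) _ _ _ that])
    show "p x ` W i \<subseteq> W i" for x i using W(5) by (simp add: \<D>_def)
    show "brn s v \<in> W i" if "s \<in> derived_g" "v \<in> W (Suc i)" for s v i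
      using I_nil that IS by simp
    show "x \<cdot> y \<in> derived_g" for x y using pI IS by simp
  qed
  have trivial: "x \<cdot> v = 0" if "x \<in> derived_g" for x v
    using derived_algebra_acts_trivially[OF red reductive_facts(1) zero that] .
  have "derived_g \<subseteq> n.bracket_space derived_g derived_g"
  proof -
    have "g.bracket_space derived_g derived_g \<subseteq> n.bracket_space derived_g derived_g"
    proof (rule g.bracket_space_least[OF n.subspace_bracket_space])
      fix x y assume xy: "x \<in> derived_g" "y \<in> derived_g"
      then have "brg x y = brn x y" by (simp add: brg_eq trivial)
      then show "brg x y \<in> n.bracket_space derived_g derived_g" using n.bracket_in_bracket_space xy by simp
    qed
    then show ?thesis by (simp only: reductive_facts(1))
  qed
  moreover have "n.solvable_set UNIV"
    using sol by (auto simp: n.solvable_set_def n.solvable_def n.derived_of_UNIV)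
  then have "n.solvable_set derived_g" using n.solvable_set_mono by blast
  ultimately have "derived_g \<subseteq> {0}" using n.perfect_solvable_trivial by blast
  then have "brn x y = 0" for x y using nI[of x y] IS by auto
  then have "n.bracket_space UNIV UNIV \<subseteq> {0}"
    by (intro n.bracket_space_least) simp_all
  then have "n.lower_central_series 1 = {0}"
    using subspace_0[OF n.subspace_bracket_space[of UNIV UNIV]] by auto
  then show False using non_nilpotent unfolding n.nilpotent_def by blast
qed

end

theorem theorem5p1:
  fixes scale :: "complex \<Rightarrow> 'v::ab_group_add \<Rightarrow> 'v"
    and basis :: "'v set"
    and brg brn :: "'v \<Rightarrow> 'v \<Rightarrow> 'v"
  assumes "finite_dimensional_vector_space scale basis"
    and "lie_algebra scale brg"
    and "lie_algebra scale brn"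
    and "lie_algebra.reductive scale brg"
    and "vector_space.dim scale (lie_algebra.center brg) = 1"
    and "lie_algebra.solvable scale brn"
    and "\<not> lie_algebra.nilpotent scale brn"
  shows "\<not> (\<exists>p. post_lie_structure scale brg brn p)"
proof
  assume "\<exists>p. post_lie_structure scale brg brn p"
  then obtain p where p: "post_lie_structure scale brg brn p" ..
  interpret post_lie_algebra scale basis brg brn p
    using assms(1-3) p
    by (simp add: post_lie_algebra_def post_lie_algebra_axioms_def complex_space_def fin_lie_algebra_def)
  show False
    using reductive_solvable_imp_nilpotent assms(4-7) by blast
qed

end
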